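(* Let $\mathbf P$ be an irreducible $s\times s$ stochastic matrix, $\mathbf a$ a known initial law (row vector), $U=\{1,\ldots,r\}$ with $1\le r\le s-1$, $\mathbf e_U\in\mathbb R^{s\times 1}$ the indicator column vector of $U$, and for $k\ge0$ let $A_k=\mathbb P(X_k\in U)=\mathbf a\mathbf P^k\mathbf e_U$ (availability) and $\widehat A_k(n)=\mathbf a\widehat{\mathbf P}(n)^k\mathbf e_U$. For every fixed $m\ge0$, $$\sqrt n\left\{(\widehat A_0(n),\ldots,\widehat A_m(n))^\top-(A_0,\ldots,A_m)^\top\right\}\xrightarrow{d}\mathbf Z_A,$$ where $(\mathbf Z_A)_k=\mathbf a\mathbf W_{\mathbf P^k}\mathbf e_U$, $k=0,\ldots,m$. Its covariance matrix is given by $$\operatorname{Cov}((\mathbf Z_A)_k,(\mathbf Z_A)_\ell)=(\mathbf a\otimes\mathbf e_U^\top)\mathbf M_k\mathbf\Sigma_{\mathbf p}\mathbf M_\ell^\top(\mathbf a^\top\otimes\mathbf e_U),\qquad k,\ell=0,\ldots,m.$$ In particular, for the cumulative availability $C_m=\sum_{k=0}^mA_k$ and its plug-in estimator $\widehat C_m(n)=\sum_{k=0}^m\widehat A_k(n)$, $$\sqrt n\{\widehat C_m(n)-C_m\}\xrightarrow{d}\sum_{k=0}^m\mathbf a\mathbf W_{\mathbf P^k}\mathbf e_U.$$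
   Context: $(X_m)_{m\ge0}$ is a time-homogeneous Markov chain on $\{1,\ldots,s\}$ with irreducible transition matrix $\mathbf P=(p_{ij})$, initial law $\mathbf a$ and stationary row vector $\boldsymbol\pi=(\pi_1,\ldots,\pi_s)$, observed along a single trajectory $X_0,\ldots,X_n$. $N_{ij}(n)$ is the number of transitions from $i$ to $j$ up to time $n$, $N_i(n)=\sum_jN_{ij}(n)$, and $\widehat{\mathbf P}(n)$ has entries $N_{ij}(n)/N_i(n)$ (and $0$ if $N_i(n)=0$). Limits are as $n\to\infty$; $\xrightarrow{d}$ is convergence in distribution. $\mathbf W=(W_{ij})$ is the centered Gaussian random $s\times s$ matrix with $\operatorname{Cov}(W_{ij},W_{kl})=\delta_{ik}\pi_i^{-1}p_{ij}(\delta_{jl}-p_{il})$. For $k\ge1$, $\mathbf W_{\mathbf P^k}=\sum_{i=0}^{k-1}\mathbf P^i\mathbf W\mathbf P^{k-1-i}$ and $\mathbf M_k=\sum_{i=0}^{k-1}\mathbf P^i\otimes(\mathbf P^{k-1-i})^\top$; also $\mathbf W_{\mathbf P^0}=\mathbf 0$ and $\mathbf M_0=\mathbf 0$. $\mathbf\Sigma_{\mathbf p}=\operatorname{Cov}(\operatorname{vec}(\mathbf W^\top))$ ($\operatorname{vec}$ stacks columns), i.e. the block diagonal matrix with blocks $\pi_i^{-1}\mathbf\Lambda_i$, $\mathbf\Lambda_i(j,k)=p_{ij}(\delta_{jk}-p_{ik})$. $\otimes$ is the Kronecker product. *)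

theory Defs
  imports "HOL-Probability.Probability"
begin

subsection \<open>Matrices\<close>

text \<open>The overloaded power and product on \<^typ>\<open>real^'s^'s\<close> are componentwise, hence a
  separate power for the matrix product.\<close>

primrec matpow :: "real^'s^'s \<Rightarrow> nat \<Rightarrow> real^'s^'s" where
  "matpow A 0 = mat 1"
| "matpow A (Suc k) = A ** matpow A k"

text \<open>The pair \<open>(i, k)\<close> indexes row (or column) \<open>k\<close> within block \<open>i\<close>, so that pairs in
  lexicographic order give the usual block layout.\<close>

definition kronecker :: "real^'n^'m \<Rightarrow> real^'q^'p \<Rightarrow> real^('n \<times> 'q)^('m \<times> 'p)" (infixl "\<otimes>\<^sub>K" 75) where
  "A \<otimes>\<^sub>K B = (\<chi> r c. A $ fst r $ fst c * B $ snd r $ snd c)"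

text \<open>Stacking of columns: the index of an entry is (column, row), again in lexicographic
  order.\<close>

definition vec_cols :: "real^'n^'m \<Rightarrow> real^('n \<times> 'm)" where
  "vec_cols A = (\<chi> c. A $ snd c $ fst c)"

definition indicator_vec :: "'s set \<Rightarrow> real^'s::finite" where
  "indicator_vec U = (\<chi> i. indicator U i)"

definition stochastic_matrix :: "real^'s^'s \<Rightarrow> bool" where
  "stochastic_matrix P \<longleftrightarrow> (\<forall>i j. 0 \<le> P $ i $ j) \<and> (\<forall>i. (\<Sum>j\<in>UNIV. P $ i $ j) = 1)"

definition irreducible_matrix :: "real^'s^'s \<Rightarrow> bool" where
  "irreducible_matrix P \<longleftrightarrow> (\<forall>i j. \<exists>k. 0 < matpow P k $ i $ j)"

definition stationary_vector :: "real^'s^'s \<Rightarrow> real^'s \<Rightarrow> bool" where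
  "stationary_vector P p \<longleftrightarrow> (\<forall>i. 0 \<le> p $ i) \<and> (\<Sum>i\<in>UNIV. p $ i) = 1 \<and> p v* P = p"

definition W_pow :: "real^'s^'s \<Rightarrow> real^'s^'s \<Rightarrow> nat \<Rightarrow> real^'s^'s" where
  "W_pow P W k = (\<Sum>i<k. matpow P i ** W ** matpow P (k - 1 - i))"

definition Z_avail :: "real^'s^'s \<Rightarrow> real^'s \<Rightarrow> 's set \<Rightarrow> real^'s^'s \<Rightarrow> nat \<Rightarrow> real" where
  "Z_avail P a U W k = (a v* W_pow P W k) \<bullet> indicator_vec U"

definition M_mat :: "real^'s^'s \<Rightarrow> nat \<Rightarrow> real^('s \<times> 's)^('s \<times> 's)" where
  "M_mat P k = (\<Sum>i<k. matpow P i \<otimes>\<^sub>K transpose (matpow P (k - 1 - i)))"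

subsection \<open>Markov chains and empirical transition matrices\<close>

definition markov_chain ::
  "'w measure \<Rightarrow> real^'s^'s \<Rightarrow> real^'s \<Rightarrow> (nat \<Rightarrow> 'w \<Rightarrow> 's::finite) \<Rightarrow> bool" where
  "markov_chain M P a X \<longleftrightarrow>
     prob_space M \<and>
     (\<forall>k. X k \<in> measurable M (count_space UNIV)) \<and>
     (\<forall>i. \<P>(\<omega> in M. X 0 \<omega> = i) = a $ i) \<and>
     (\<forall>k x j. \<P>(\<omega> in M. \<forall>t\<le>k. X t \<omega> = x t) > 0 \<longrightarrow>
        \<P>(\<omega> in M. X (Suc k) \<omega> = j \<bar> \<forall>t\<le>k. X t \<omega> = x t) = P $ x k $ j)"

definition transition_count :: "(nat \<Rightarrow> 's) \<Rightarrow> nat \<Rightarrow> 's \<Rightarrow> 's \<Rightarrow> nat" where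
  "transition_count x n i j = card {t. t < n \<and> x t = i \<and> x (Suc t) = j}"

definition visit_count :: "(nat \<Rightarrow> 's::finite) \<Rightarrow> nat \<Rightarrow> 's \<Rightarrow> nat" where
  "visit_count x n i = (\<Sum>j\<in>UNIV. transition_count x n i j)"

definition empirical_matrix :: "(nat \<Rightarrow> 's::finite) \<Rightarrow> nat \<Rightarrow> real^'s^'s" where
  "empirical_matrix x n =
     (\<chi> i j. if visit_count x n i = 0 then 0
             else real (transition_count x n i j) / real (visit_count x n i))"

definition availability :: "'w measure \<Rightarrow> (nat \<Rightarrow> 'w \<Rightarrow> 's) \<Rightarrow> 's set \<Rightarrow> nat \<Rightarrow> real" where
  "availability M X U k = \<P>(\<omega> in M. X k \<omega> \<in> U)"

definition availability_est :: "real^'s \<Rightarrow> 's set \<Rightarrow> nat \<Rightarrow> nat \<Rightarrow> (nat \<Rightarrow> 's::finite) \<Rightarrow> real" where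
  "availability_est a U k n x = (a v* matpow (empirical_matrix x n) k) \<bullet> indicator_vec U"

subsection \<open>Gaussian vectors, covariance, convergence in distribution\<close>

text \<open>Degenerate normal laws (\<open>\<sigma> = 0\<close>) are point masses; \<^const>\<open>normal_density\<close> does not
  cover this case.\<close>

definition normal_law :: "real \<Rightarrow> real \<Rightarrow> real measure" where
  "normal_law \<mu> \<sigma> =
     (if \<sigma> = 0 then return borel \<mu> else density lborel (\<lambda>x. ennreal (normal_density \<mu> \<sigma> x)))"

definition centered_gaussian :: "'v measure \<Rightarrow> ('v \<Rightarrow> 'b::euclidean_space) \<Rightarrow> bool" where
  "centered_gaussian N W \<longleftrightarrow>
     W \<in> borel_measurable N \<and>
     (\<forall>c. \<exists>\<sigma>\<ge>0. distr N borel (\<lambda>\<omega>. c \<bullet> W \<omega>) = normal_law 0 \<sigma>)"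

definition covariance :: "'v measure \<Rightarrow> ('v \<Rightarrow> real) \<Rightarrow> ('v \<Rightarrow> real) \<Rightarrow> real" where
  "covariance N Y Z =
     (\<integral>\<omega>. (Y \<omega> - (\<integral>\<eta>. Y \<eta> \<partial>N)) * (Z \<omega> - (\<integral>\<eta>. Z \<eta> \<partial>N)) \<partial>N)"

definition covariance_matrix :: "'v measure \<Rightarrow> ('v \<Rightarrow> real^'d) \<Rightarrow> real^'d^'d" where
  "covariance_matrix N Y = (\<chi> i j. covariance N (\<lambda>\<omega>. Y \<omega> $ i) (\<lambda>\<omega>. Y \<omega> $ j))"

definition Sigma_p :: "'v measure \<Rightarrow> ('v \<Rightarrow> real^'s^'s) \<Rightarrow> real^('s \<times> 's)^('s \<times> 's)" where
  "Sigma_p N W = covariance_matrix N (\<lambda>\<omega>. vec_cols (transpose (W \<omega>)))"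

definition borel_on :: "'b topology \<Rightarrow> 'b measure" where
  "borel_on T = sigma (topspace T) {S. openin T S}"

text \<open>Weak convergence of the laws, by bounded continuous test functions. The limit may live on a
  different probability space.\<close>

definition converges_in_distribution ::
  "'b topology \<Rightarrow> 'w measure \<Rightarrow> (nat \<Rightarrow> 'w \<Rightarrow> 'b) \<Rightarrow> 'v measure \<Rightarrow> ('v \<Rightarrow> 'b) \<Rightarrow> bool" where
  "converges_in_distribution T M Y N Z \<longleftrightarrow>
     (\<forall>n. Y n \<in> measurable M (borel_on T)) \<and> Z \<in> measurable N (borel_on T) \<and>
     (\<forall>f. continuous_map T euclideanreal f \<and> bounded (f ` topspace T) \<longrightarrow>
        (\<lambda>n. \<integral>\<omega>. f (Y n \<omega>) \<partial>M) \<longlonglongrightarrow> (\<integral>\<omega>. f (Z \<omega>) \<partial>N))"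

text \<open>The vector \<open>(v 0, \<dots>, v m)\<close> as a point of \<^term>\<open>Euclidean_space (Suc m)\<close>, which consists
  of the sequences vanishing from index \<open>Suc m\<close> on.\<close>

definition tuple_upto :: "nat \<Rightarrow> (nat \<Rightarrow> real) \<Rightarrow> nat \<Rightarrow> real" where
  "tuple_upto m v = (\<lambda>k. if k \<le> m then v k else 0)"

end

theory Submission
  imports Defs
begin

text \<open>
  Write \<open>Q\<close> for the empirical matrix. Telescoping gives
  \<open>Q^k - P^k = (\<Sum>i<k. P^i (Q - P) Q^(k-1-i))\<close>, so the errors of all availabilities up to time
  \<open>m\<close> are one continuous function of the pair formed by \<open>sqrt n (Q - P)\<close> and \<open>Q\<close>. Once the first
  component converges in law to \<open>W\<close> and the second to the constant \<open>P\<close>, the continuous mapping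
  theorem yields the limit \<open>a W_(P^k) e_U\<close>, and the covariance formula is bilinearity.

  The division by the random visit counts is postponed. With \<open>L\<close> the fractions of time spent in the
  states and \<open>V\<close> the matrix of the sums \<open>1{X_t = i} (1{X_(t+1) = j} - p_ij)\<close> divided by \<open>sqrt n\<close>,
  \<open>sqrt n (Q - P)\<close> has rows \<open>V_i / L_i\<close> as soon as every state has been visited. Hence it is enough
  to find the limit in law of the triple \<open>(V, L, 1 / sqrt n)\<close>, which is \<open>(\<pi>_i W_ij, \<pi>, 0)\<close>.

  Every linear functional of \<open>V\<close> is a normalised sum of martingale differences \<open>g(X_t, X_(t+1))\<close>.
  Its characteristic function is followed step by step (\<open>clt_path_sum\<close>). Averaging out one transition
  multiplies \<open>exp(i \<theta> S_t)\<close> by \<open>1 - \<theta>^2 v(X_t) / 2\<close> up to \<open>O(\<theta>^3)\<close>, where \<open>v\<close> is the conditional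
  variance, and the fluctuation of \<open>v\<close> around its stationary mean \<open>\<sigma>^2\<close> is removed by a solution \<open>h\<close> of the Poisson
  equation \<open>h - P h = v - \<sigma>^2\<close>: the corrected quantity
  \<open>E (exp(i \<theta> S_t) (1 - \<theta>^2 h(X_t) / 2))\<close> is multiplied by the constant \<open>1 - \<theta>^2 \<sigma>^2 / 2\<close> up to an
  error \<open>O(\<theta>^3)\<close>. With \<open>\<theta> = 1 / sqrt n\<close> the \<open>n\<close> errors add up to \<open>O(1 / sqrt n)\<close>. The same
  equation, for the indicator of a state, shows \<open>L \<rightarrow> \<pi>\<close> in mean (\<open>occupation_tendsto\<close>).

  Convergence of characteristic functions is turned into weak convergence in several dimensions by
  \<open>multivariate_levy_continuity\<close>. Tightness comes from the one-dimensional theorem applied to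
  coordinates; on a large cube a bounded continuous function is approximated by a trigonometric
  polynomial that stays bounded on the whole space.
\<close>

section \<open>Characteristic functions determine weak convergence\<close>

text \<open>Complex trigonometric polynomials with arbitrary real frequencies. Convergence of
  characteristic functions says precisely that expectations of these functions converge.\<close>

inductive trig_poly :: "('b::euclidean_space \<Rightarrow> complex) \<Rightarrow> bool" where
  wave: "trig_poly (\<lambda>x. iexp (c \<bullet> x))"
| scale: "trig_poly f \<Longrightarrow> trig_poly (\<lambda>x. z * f x)"
| add: "trig_poly f \<Longrightarrow> trig_poly g \<Longrightarrow> trig_poly (\<lambda>x. f x + g x)"

lemma trig_poly_const: "trig_poly (\<lambda>x::'b::euclidean_space. z)"
  using trig_poly.scale[OF trig_poly.wave[of "0::'b"], of z] by simp

lemma trig_poly_wave_mult: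
  assumes "trig_poly g"
  shows "trig_poly (\<lambda>x. iexp (c \<bullet> x) * g x)"
  using assms
proof induction
  case (wave d)
  have "(\<lambda>x. iexp (c \<bullet> x) * iexp (d \<bullet> x)) = (\<lambda>x. iexp ((c + d) \<bullet> x))"
    by (simp add: fun_eq_iff inner_add_left exp_add[symmetric] algebra_simps)
  then show ?case using trig_poly.wave[of "c + d"] by simp
next
  case (scale f z)
  then show ?case using trig_poly.scale[OF scale.IH, of z] by (simp add: mult.left_commute)
next
  case (add f g)
  then show ?case using trig_poly.add[OF add.IH] by (simp add: distrib_left)
qed

lemma trig_poly_mult:
  assumes "trig_poly f" "trig_poly g"
  shows "trig_poly (\<lambda>x. f x * g x)"
  using assms(1)
proof induction
  case (wave c)
  then show ?case by (rule trig_poly_wave_mult[OF assms(2)])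
next
  case (scale f z)
  then show ?case using trig_poly.scale[OF scale.IH, of z] by (simp add: mult.assoc)
next
  case (add f h)
  then show ?case using trig_poly.add[OF add.IH] by (simp add: distrib_right)
qed

lemma trig_poly_sum:
  assumes "\<And>b. b \<in> B \<Longrightarrow> trig_poly (f b)"
  shows "trig_poly (\<lambda>x. \<Sum>b\<in>B. f b x)"
  using assms
  by (induction B rule: infinite_finite_induct) (auto intro: trig_poly_const trig_poly.add)

lemma trig_poly_sin: "trig_poly (\<lambda>x. complex_of_real (sin (c \<bullet> x)))"
proof -
  have "(\<lambda>x. complex_of_real (sin (c \<bullet> x))) =
      (\<lambda>x. (1 / (2*\<i>)) * iexp (c \<bullet> x) + (-1 / (2*\<i>)) * iexp ((-c) \<bullet> x))"
    by (simp add: fun_eq_iff sin_exp_eq field_simps flip: sin_of_real)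
  then show ?thesis
    by (simp only:) (intro trig_poly.intros)
qed

text \<open>A polynomial composed with this map is a trigonometric polynomial. Since the map takes values in
  the unit cube and is injective on the cube of half-width \<open>L\<close>, with inverse given by \<open>arcsin\<close>,
  approximation on the unit cube by polynomials becomes approximation by globally bounded
  trigonometric polynomials.\<close>

definition sin_coords :: "real \<Rightarrow> 'b::euclidean_space \<Rightarrow> 'b" where
  "sin_coords L x = (\<Sum>b\<in>Basis. sin ((x \<bullet> b) / L) *\<^sub>R b)"

lemma trig_poly_sin_coords:
  assumes "real_polynomial_function p"
  shows "trig_poly (\<lambda>x. complex_of_real (p (sin_coords L x)))"
  using assms
proof induction
  case (linear f)
  interpret bounded_linear f by fact
  have "f (sin_coords L x) = (\<Sum>b\<in>Basis. f b * sin ((b /\<^sub>R L) \<bullet> x))" for x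
    by (simp add: sin_coords_def sum scaleR inner_commute field_simps)
  then show ?case
    by (simp del: inner_scaleR_left, intro trig_poly_sum trig_poly.scale trig_poly_sin)
next
  case (const c)
  show ?case by (rule trig_poly_const)
next
  case (add f g)
  then show ?case using trig_poly.add by simp
next
  case (mult f g)
  then show ?case using trig_poly_mult by simp
qed

lemma trig_poly_continuous: "trig_poly f \<Longrightarrow> continuous_on UNIV f"
  by (induction rule: trig_poly.induct) (auto intro!: continuous_intros)

lemma trig_poly_bounded: "trig_poly f \<Longrightarrow> \<exists>B. \<forall>x. cmod (f x) \<le> B"
proof (induction rule: trig_poly.induct)
  case (wave c)
  show ?case by (rule exI[of _ 1]) simp
next
  case (scale f z)
  then show ?case by (metis norm_mult mult_left_mono norm_ge_zero)
next
  case (add f g)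
  then show ?case by (meson add_mono norm_triangle_le)
qed

lemma (in prob_space) integrable_trig_poly:
  assumes "trig_poly f" "Y \<in> borel_measurable M"
  shows "integrable M (\<lambda>\<omega>. f (Y \<omega>))"
proof -
  obtain B where "\<forall>x. cmod (f x) \<le> B" using trig_poly_bounded[OF assms(1)] by blast
  moreover have "f \<in> borel_measurable borel"
    using trig_poly_continuous[OF assms(1)] by (rule borel_measurable_continuous_onI)
  ultimately show ?thesis
    using assms(2) by (intro integrable_const_bound[of _ B]) auto
qed

lemma (in prob_space) integrable_bounded_continuous:
  fixes f :: "'b::euclidean_space \<Rightarrow> real"
  assumes "continuous_on UNIV f" "\<And>x. \<bar>f x\<bar> \<le> B" "Y \<in> borel_measurable M"
  shows "integrable M (\<lambda>\<omega>. f (Y \<omega>))"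
proof -
  have [measurable]: "f \<in> borel_measurable borel"
    using assms(1) by (rule borel_measurable_continuous_onI)
  show ?thesis
    using assms(2,3) by (intro integrable_const_bound[of _ B]) auto
qed

lemma trig_poly_expectation_tendsto:
  fixes Y :: "nat \<Rightarrow> 'w \<Rightarrow> 'b::euclidean_space"
  assumes "prob_space M" "prob_space N"
    and [measurable]: "\<And>n. Y n \<in> borel_measurable M" "Z \<in> borel_measurable N"
    and char: "\<And>c. (\<lambda>n. \<integral>\<omega>. iexp (c \<bullet> Y n \<omega>) \<partial>M) \<longlonglongrightarrow> (\<integral>\<omega>. iexp (c \<bullet> Z \<omega>) \<partial>N)"
    and f: "trig_poly f"
  shows "(\<lambda>n. \<integral>\<omega>. f (Y n \<omega>) \<partial>M) \<longlonglongrightarrow> (\<integral>\<omega>. f (Z \<omega>) \<partial>N)"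
proof -
  interpret M: prob_space M by fact
  interpret N: prob_space N by fact
  show ?thesis
    using f
  proof induction
    case (wave c)
    then show ?case by (rule char)
  next
    case (scale f z)
    then show ?case by (simp add: tendsto_mult_left)
  next
    case (add f g)
    then show ?case
      by (simp add: Bochner_Integration.integral_add[OF M.integrable_trig_poly M.integrable_trig_poly]
          Bochner_Integration.integral_add[OF N.integrable_trig_poly N.integrable_trig_poly] tendsto_add)
  qed
qed

text \<open>A continuous substitute for the indicator of \<open>\<bar>t\<bar> > L\<close>, so that its expectations pass to the
  limit under weak convergence.\<close>

definition tail_weight :: "real \<Rightarrow> real \<Rightarrow> real" where
  "tail_weight L t = min 1 (max 0 (\<bar>t\<bar> - L))"

lemma tail_weight_bounds: "0 \<le> tail_weight L t" "tail_weight L t \<le> 1"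
  by (auto simp: tail_weight_def)

lemma continuous_tail_weight: "continuous_on UNIV (tail_weight L)"
  unfolding tail_weight_def by (intro continuous_intros)

text \<open>The characteristic function of a coordinate is a restriction of the joint one, so the
  one-dimensional continuity theorem applies to each coordinate.\<close>

lemma expectation_tail_weight_tendsto:
  fixes Y :: "nat \<Rightarrow> 'w \<Rightarrow> 'b::euclidean_space"
  assumes "prob_space M" "prob_space N"
    and [measurable]: "\<And>n. Y n \<in> borel_measurable M" "Z \<in> borel_measurable N"
    and char: "\<And>c. (\<lambda>n. \<integral>\<omega>. iexp (c \<bullet> Y n \<omega>) \<partial>M) \<longlonglongrightarrow> (\<integral>\<omega>. iexp (c \<bullet> Z \<omega>) \<partial>N)"
  shows "(\<lambda>n. \<integral>\<omega>. tail_weight L (Y n \<omega> \<bullet> b) \<partial>M) \<longlonglongrightarrow> (\<integral>\<omega>. tail_weight L (Z \<omega> \<bullet> b) \<partial>N)"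
proof -
  interpret M: prob_space M by fact
  interpret N: prob_space N by fact
  let ?A = "\<lambda>n. distr M borel (\<lambda>\<omega>. Y n \<omega> \<bullet> b)" and ?B = "distr N borel (\<lambda>\<omega>. Z \<omega> \<bullet> b)"
  have A: "real_distribution (?A n)" for n
    by (rule M.real_distribution_distr) measurable
  have B: "real_distribution ?B"
    by (rule N.real_distribution_distr) measurable
  have cA: "char (?A n) t = (\<integral>\<omega>. iexp ((t *\<^sub>R b) \<bullet> Y n \<omega>) \<partial>M)" for n t
    unfolding char_def by (subst integral_distr) (auto simp: inner_commute)
  have cB: "char ?B t = (\<integral>\<omega>. iexp ((t *\<^sub>R b) \<bullet> Z \<omega>) \<partial>N)" for t
    unfolding char_def by (subst integral_distr) (auto simp: inner_commute)
  have "weak_conv_m ?A ?B"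
    by (rule levy_continuity[OF A B]) (unfold cA cB, rule char)
  then have "(\<lambda>n. integral\<^sup>L (?A n) (tail_weight L)) \<longlonglongrightarrow> integral\<^sup>L ?B (tail_weight L)"
    by (rule weak_conv_imp_integral_bdd_continuous_conv[OF A B, where B = 1])
      (use continuous_tail_weight tail_weight_bounds in \<open>auto simp: continuous_on_eq_continuous_at\<close>)
  moreover have "tail_weight L \<in> borel_measurable borel"
    using continuous_tail_weight by (rule borel_measurable_continuous_onI)
  ultimately show ?thesis
    by (simp add: integral_distr)
qed

lemma (in prob_space) expectation_tail_weight_vanishes:
  assumes [measurable]: "X \<in> borel_measurable M"
  shows "(\<lambda>l. \<integral>\<omega>. tail_weight (real l) (X \<omega>) \<partial>M) \<longlonglongrightarrow> 0"
proof -
  have [measurable]: "tail_weight L \<in> borel_measurable borel" for L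
    using continuous_tail_weight by (rule borel_measurable_continuous_onI)
  have "(\<lambda>l. \<integral>\<omega>. tail_weight (real l) (X \<omega>) \<partial>M) \<longlonglongrightarrow> (\<integral>\<omega>. 0 \<partial>M)"
  proof (rule integral_dominated_convergence[where w = "\<lambda>_. 1"])
    show "AE \<omega> in M. (\<lambda>l. tail_weight (real l) (X \<omega>)) \<longlonglongrightarrow> 0"
    proof (intro AE_I2 tendsto_eventually)
      fix \<omega>
      show "\<forall>\<^sub>F l in sequentially. tail_weight (real l) (X \<omega>) = 0"
        using eventually_ge_at_top[of "nat \<lceil>\<bar>X \<omega>\<bar>\<rceil>"]
      proof eventually_elim
        case (elim l)
        then have "\<bar>X \<omega>\<bar> \<le> real l" by linarith
        then show ?case by (simp add: tail_weight_def)
      qed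
    qed
  qed (use tail_weight_bounds in auto)
  then show ?thesis by simp
qed

text \<open>The continuous function \<open>f\<close> equals \<open>F \<circ> sin_coords L\<close> on the cube of half-width \<open>L\<close>, with
  \<open>F y = f (L arcsin y)\<close>. Replacing \<open>F\<close> by a polynomial on the unit cube changes \<open>f\<close> by at most \<open>d\<close>
  inside the large cube and by at most \<open>2 B + d\<close> elsewhere, where the tail weight \<open>K\<close> is at least
  \<open>1\<close>. Expectations of the trigonometric polynomial and of \<open>K\<close> converge.\<close>

theorem multivariate_levy_continuity:
  fixes Y :: "nat \<Rightarrow> 'w \<Rightarrow> 'b::euclidean_space" and f :: "'b \<Rightarrow> real"
  assumes "prob_space M" "prob_space N"
    and [measurable]: "\<And>n. Y n \<in> borel_measurable M" "Z \<in> borel_measurable N"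
    and char: "\<And>c. (\<lambda>n. \<integral>\<omega>. iexp (c \<bullet> Y n \<omega>) \<partial>M) \<longlonglongrightarrow> (\<integral>\<omega>. iexp (c \<bullet> Z \<omega>) \<partial>N)"
    and f: "continuous_on UNIV f" "\<And>x. \<bar>f x\<bar> \<le> B"
  shows "(\<lambda>n. \<integral>\<omega>. f (Y n \<omega>) \<partial>M) \<longlonglongrightarrow> (\<integral>\<omega>. f (Z \<omega>) \<partial>N)"
proof -
  interpret M: prob_space M by fact
  interpret N: prob_space N by fact
  have B: "0 \<le> B" using f(2)[of 0] by linarith
  define K where "K = (\<lambda>L (x::'b). \<Sum>b\<in>Basis. tail_weight L (x \<bullet> b))"
  have tw: "continuous_on UNIV (\<lambda>x::'b. tail_weight L (x \<bullet> b))" for L b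
    by (rule continuous_on_compose2[OF continuous_tail_weight]) (auto intro!: continuous_intros)
  have K_int: "integrable Q (\<lambda>\<omega>. K L (X \<omega>))" if "prob_space Q" "X \<in> borel_measurable Q" for L X and Q :: "'q measure"
    unfolding K_def
    by (intro Bochner_Integration.integrable_sum prob_space.integrable_bounded_continuous[where B = 1, OF that(1) tw _ that(2)])
      (use tail_weight_bounds in auto)
  have K_sum: "(\<integral>\<omega>. K L (X \<omega>) \<partial>Q) = (\<Sum>b\<in>Basis. \<integral>\<omega>. tail_weight L (X \<omega> \<bullet> b) \<partial>Q)"
    if "prob_space Q" "X \<in> borel_measurable Q" for L X and Q :: "'q measure"
    unfolding K_def
    by (intro Bochner_Integration.integral_sum prob_space.integrable_bounded_continuous[where B = 1, OF that(1) tw _ that(2)])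
      (use tail_weight_bounds in auto)
  have K_nonneg: "0 \<le> K L x" for L x
    unfolding K_def by (intro sum_nonneg tail_weight_bounds)
  have K_Y: "(\<lambda>n. \<integral>\<omega>. K L (Y n \<omega>) \<partial>M) \<longlonglongrightarrow> (\<integral>\<omega>. K L (Z \<omega>) \<partial>N)" for L
    unfolding K_sum[OF assms(1) assms(3)] K_sum[OF assms(2) assms(4)]
    by (intro tendsto_sum expectation_tail_weight_tendsto assms)
  have K_Z: "(\<lambda>l. \<integral>\<omega>. K (real l) (Z \<omega>) \<partial>N) \<longlonglongrightarrow> 0"
    unfolding K_sum[OF assms(2) assms(4)]
    by (intro tendsto_null_sum N.expectation_tail_weight_vanishes) measurable
  have key: "\<forall>\<^sub>F n in sequentially. \<bar>(\<integral>\<omega>. f (Y n \<omega>) \<partial>M) - (\<integral>\<omega>. f (Z \<omega>) \<partial>N)\<bar> < e"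
    if "e > 0" for e
  proof -
    define d where "d = min 1 (e / (4 + 4 * (2 * B + 1)))"
    have d: "0 < d" "d \<le> 1"
      using that B by (auto simp: d_def)
    have "d \<le> e / (4 + 4 * (2 * B + 1))"
      by (simp add: d_def)
    then have d_e: "d * (4 + 4 * (2 * B + 1)) \<le> e"
      using B by (subst (asm) pos_le_divide_eq) auto
    have "\<forall>\<^sub>F l in sequentially. (\<integral>\<omega>. K (real l) (Z \<omega>) \<partial>N) < d"
      by (rule order_tendstoD(2)[OF K_Z d(1)])
    then obtain l where l: "(\<integral>\<omega>. K (real l) (Z \<omega>) \<partial>N) < d"
      by (meson eventually_sequentially order_refl)
    \<comment> \<open>a point outside the cube of half-width \<open>l + 1\<close> has tail weight at least \<open>1\<close> at level \<open>l\<close>\<close>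
    define L where "L = real l + 1"
    have L: "L > 0" by (simp add: L_def)
    \<comment> \<open>clamping makes \<open>F\<close> continuous everywhere; on the unit cube it has no effect\<close>
    define F where "F = (\<lambda>y::'b. f (\<Sum>b\<in>Basis. (L * arcsin (max (-1) (min 1 (y \<bullet> b)))) *\<^sub>R b))"
    have "continuous_on UNIV F"
      unfolding F_def
      by (intro continuous_on_compose2[OF f(1)] continuous_intros) auto
    then have "continuous_on (cbox (- One) One) F"
      by (rule continuous_on_subset) simp
    then obtain p where p: "real_polynomial_function p" "\<And>y. y \<in> cbox (- One) One \<Longrightarrow> \<bar>F y - p y\<bar> < d"
      using Stone_Weierstrass_real_polynomial_function[OF compact_cbox _ d(1)] by metis
    define g where "g = (\<lambda>x. p (sin_coords L x))"
    have comp: "sin_coords L x \<bullet> b = sin ((x \<bullet> b) / L)" if "b \<in> Basis" for x b :: 'b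
      using that by (simp add: sin_coords_def inner_sum_left inner_Basis if_distrib cong: if_cong)
    have box: "sin_coords L x \<in> cbox (- One) One" for x :: 'b
      by (simp add: mem_box comp)
    have Fg: "\<bar>F (sin_coords L x) - g x\<bar> < d" for x
      unfolding g_def by (rule p(2)[OF box])
    have FB: "\<bar>F y\<bar> \<le> B" for y
      unfolding F_def by (rule f(2))
    have Ff: "F (sin_coords L x) = f x" if "\<And>b. b \<in> Basis \<Longrightarrow> \<bar>x \<bullet> b\<bar> \<le> L" for x
    proof -
      have "L * arcsin (max (-1) (min 1 (sin_coords L x \<bullet> b))) = x \<bullet> b" if b: "b \<in> Basis" for b
      proof -
        have "\<bar>(x \<bullet> b) / L\<bar> \<le> 1" using \<open>\<And>b. b \<in> Basis \<Longrightarrow> \<bar>x \<bullet> b\<bar> \<le> L\<close>[OF b] L by simp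
        then have "arcsin (sin ((x \<bullet> b) / L)) = (x \<bullet> b) / L"
          using pi_gt3 unfolding abs_le_iff by (intro arcsin_sin) linarith+
        then show ?thesis using L by (simp add: comp[OF b])
      qed
      then show ?thesis by (simp add: F_def euclidean_representation)
    qed
    have fg: "\<bar>f x - g x\<bar> \<le> d + (2 * B + 1) * K (real l) x" for x
    proof (cases "\<forall>b\<in>Basis. \<bar>x \<bullet> b\<bar> \<le> L")
      case True
      then have "\<bar>f x - g x\<bar> < d" using Fg[of x] Ff[of x] by simp
      moreover have "0 \<le> (2 * B + 1) * K (real l) x" using K_nonneg B by simp
      ultimately show ?thesis by linarith
    next
      case False
      then obtain b where b: "b \<in> Basis" "\<bar>x \<bullet> b\<bar> > L" by force
      then have "1 = tail_weight (real l) (x \<bullet> b)" by (auto simp: tail_weight_def L_def)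
      also have "\<dots> \<le> K (real l) x"
        unfolding K_def using b(1) by (intro member_le_sum tail_weight_bounds) auto
      finally have "2 * B + 1 \<le> (2 * B + 1) * K (real l) x" using B by simp
      moreover have "\<bar>f x - g x\<bar> \<le> 2 * B + d"
        using Fg[of x] FB[of "sin_coords L x"] f(2)[of x] by linarith
      ultimately show ?thesis using d by linarith
    qed
    have g_trig: "trig_poly (\<lambda>x. complex_of_real (g x))"
      unfolding g_def by (rule trig_poly_sin_coords[OF p(1)])
    have g_int: "integrable Q (\<lambda>\<omega>. g (X \<omega>))" if "prob_space Q" "X \<in> borel_measurable Q" for X and Q :: "'q measure"
      using prob_space.integrable_trig_poly[OF that(1) g_trig that(2)] by (simp only: complex_of_real_integrable_eq)
    have f_int: "integrable Q (\<lambda>\<omega>. f (X \<omega>))" if "prob_space Q" "X \<in> borel_measurable Q" for X and Q :: "'q measure"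
      by (rule prob_space.integrable_bounded_continuous[OF that(1) f that(2)])
    have g_conv: "(\<lambda>n. \<integral>\<omega>. g (Y n \<omega>) \<partial>M) \<longlonglongrightarrow> (\<integral>\<omega>. g (Z \<omega>) \<partial>N)"
      using tendsto_Re[OF trig_poly_expectation_tendsto[OF assms(1-4) char g_trig]] by simp
    have approx: "\<bar>(\<integral>\<omega>. f (X \<omega>) \<partial>Q) - (\<integral>\<omega>. g (X \<omega>) \<partial>Q)\<bar> \<le> d + (2 * B + 1) * (\<integral>\<omega>. K (real l) (X \<omega>) \<partial>Q)"
      if Q: "prob_space Q" "X \<in> borel_measurable Q" for X and Q :: "'q measure"
    proof -
      interpret Q: prob_space Q by fact
      have "\<bar>(\<integral>\<omega>. f (X \<omega>) \<partial>Q) - (\<integral>\<omega>. g (X \<omega>) \<partial>Q)\<bar> = \<bar>\<integral>\<omega>. f (X \<omega>) - g (X \<omega>) \<partial>Q\<bar>"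
        using f_int[OF Q] g_int[OF Q] by simp
      also have "\<dots> \<le> (\<integral>\<omega>. d + (2 * B + 1) * K (real l) (X \<omega>) \<partial>Q)"
        using f_int[OF Q] g_int[OF Q] K_int[OF Q] fg
        by (intro order_trans[OF integral_abs_bound integral_mono]) auto
      also have "\<dots> = d + (2 * B + 1) * (\<integral>\<omega>. K (real l) (X \<omega>) \<partial>Q)"
        using K_int[OF Q] by (simp add: Q.prob_space)
      finally show ?thesis .
    qed
    have "\<forall>\<^sub>F n in sequentially. (\<integral>\<omega>. K (real l) (Y n \<omega>) \<partial>M) < d"
      by (rule order_tendstoD(2)[OF K_Y l])
    moreover have "\<forall>\<^sub>F n in sequentially. \<bar>(\<integral>\<omega>. g (Y n \<omega>) \<partial>M) - (\<integral>\<omega>. g (Z \<omega>) \<partial>N)\<bar> < d"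
      using tendstoD[OF g_conv d(1)] by (simp add: dist_real_def)
    ultimately show ?thesis
    proof eventually_elim
      case (elim n)
      have 1: "(2 * B + 1) * (\<integral>\<omega>. K (real l) (Y n \<omega>) \<partial>M) \<le> (2 * B + 1) * d"
        and 2: "(2 * B + 1) * (\<integral>\<omega>. K (real l) (Z \<omega>) \<partial>N) \<le> (2 * B + 1) * d"
        using elim l B by (auto intro!: mult_left_mono)
      have "d * (4 + 4 * (2 * B + 1)) = 4 * d + 4 * ((2 * B + 1) * d)"
        by (simp add: algebra_simps)
      moreover have "0 \<le> (2 * B + 1) * d" using B d by simp
      ultimately show ?case
        using approx[OF assms(1) assms(3)[of n]] approx[OF assms(2,4)] elim(2) 1 2 d d_e by linarith
    qed
  qed
  show ?thesis
    by (rule tendstoI) (use key in \<open>simp add: dist_real_def\<close>)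
qed

section \<open>Centred Gaussian matrices\<close>

text \<open>Scaling a standard normal variable covers the degenerate case \<open>\<sigma> = 0\<close> as well, so that moments
  and characteristic functions need no case distinction.\<close>

lemma normal_law_eq_distr:
  assumes "0 \<le> \<sigma>"
  shows "normal_law 0 \<sigma> = distr std_normal_distribution borel (\<lambda>x. \<sigma> * x)"
proof (cases "\<sigma> = 0")
  case True
  interpret S: prob_space std_normal_distribution
    by (rule prob_space_normal_density) simp
  show ?thesis
    using True by (simp add: normal_law_def)
next
  case False
  interpret S: prob_space std_normal_distribution
    by (rule prob_space_normal_density) simp
  have "distributed std_normal_distribution lborel (\<lambda>x. x) std_normal_density"
    by (auto simp: distributed_def distr_id2)
  then have "distributed std_normal_distribution lborel (\<lambda>x. 0 + x * \<sigma>) (normal_density (0 + 0 * \<sigma>) (\<bar>\<sigma>\<bar> * 1))"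
    using False S.normal_density_affine[of "\<lambda>x. x" 0 1 \<sigma> 0] by (simp add: mult.commute)
  then have "distr std_normal_distribution lborel (\<lambda>x. \<sigma> * x) = density lborel (normal_density 0 \<sigma>)"
    using assms by (simp add: distributed_def mult.commute)
  moreover have "distr std_normal_distribution lborel (\<lambda>x. \<sigma> * x) = distr std_normal_distribution borel (\<lambda>x. \<sigma> * x)"
    by (rule distr_cong) auto
  ultimately show ?thesis using False by (simp add: normal_law_def)
qed

lemma
  assumes "0 \<le> \<sigma>"
  shows char_normal_law: "(\<integral>x. iexp x \<partial>normal_law 0 \<sigma>) = exp (- \<sigma>\<^sup>2 / 2)"
    and normal_law_mean: "(\<integral>x. x \<partial>normal_law 0 \<sigma>) = 0"
    and normal_law_integrable_square: "integrable (normal_law 0 \<sigma>) (\<lambda>x. x\<^sup>2)"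
    and normal_law_second_moment: "(\<integral>x. x\<^sup>2 \<partial>normal_law 0 \<sigma>) = \<sigma>\<^sup>2"
proof -
  have "(\<integral>x. iexp x \<partial>normal_law 0 \<sigma>) = char std_normal_distribution \<sigma>"
    unfolding normal_law_eq_distr[OF assms] char_def by (subst integral_distr) simp_all
  then show "(\<integral>x. iexp x \<partial>normal_law 0 \<sigma>) = exp (- \<sigma>\<^sup>2 / 2)"
    by (simp add: char_std_normal_distribution)
  show "(\<integral>x. x \<partial>normal_law 0 \<sigma>) = 0"
    unfolding normal_law_eq_distr[OF assms]
    using integral_std_normal_distribution_moment_odd[of 1] by (subst integral_distr) simp_all
  have 2: "integrable std_normal_distribution (\<lambda>x. (\<sigma> * x)\<^sup>2)"
    using integrable_std_normal_distribution_moment[of 2] by (simp add: power_mult_distrib)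
  then show "integrable (normal_law 0 \<sigma>) (\<lambda>x. x\<^sup>2)"
    unfolding normal_law_eq_distr[OF assms] by (subst integrable_distr_eq) simp_all
  have "(\<integral>x. x\<^sup>2 \<partial>std_normal_distribution) = 1"
    using std_normal_distribution_even_moments(1)[of 1] by (simp add: fact_numeral)
  then show "(\<integral>x. x\<^sup>2 \<partial>normal_law 0 \<sigma>) = \<sigma>\<^sup>2"
    unfolding normal_law_eq_distr[OF assms] by (subst integral_distr) (simp_all add: power_mult_distrib)
qed

lemma
  assumes W: "centered_gaussian N W"
  shows gaussian_char: "(\<integral>\<omega>. iexp (c \<bullet> W \<omega>) \<partial>N) = exp (- (\<integral>\<omega>. (c \<bullet> W \<omega>)\<^sup>2 \<partial>N) / 2)"
    and gaussian_mean: "(\<integral>\<omega>. c \<bullet> W \<omega> \<partial>N) = 0"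
    and gaussian_integrable_square: "integrable N (\<lambda>\<omega>. (c \<bullet> W \<omega>)\<^sup>2)"
proof -
  have [measurable]: "W \<in> borel_measurable N"
    using W by (simp add: centered_gaussian_def)
  obtain \<sigma> where \<sigma>: "0 \<le> \<sigma>" "distr N borel (\<lambda>\<omega>. c \<bullet> W \<omega>) = normal_law 0 \<sigma>"
    using W unfolding centered_gaussian_def by blast
  have "(\<integral>\<omega>. iexp (c \<bullet> W \<omega>) \<partial>N) = (\<integral>x. iexp x \<partial>normal_law 0 \<sigma>)"
    unfolding \<sigma>(2)[symmetric] by (subst integral_distr) simp_all
  moreover have sq: "(\<integral>\<omega>. (c \<bullet> W \<omega>)\<^sup>2 \<partial>N) = (\<integral>x. x\<^sup>2 \<partial>normal_law 0 \<sigma>)"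
    unfolding \<sigma>(2)[symmetric] by (subst integral_distr) simp_all
  ultimately show "(\<integral>\<omega>. iexp (c \<bullet> W \<omega>) \<partial>N) = exp (- (\<integral>\<omega>. (c \<bullet> W \<omega>)\<^sup>2 \<partial>N) / 2)"
    by (simp add: char_normal_law[OF \<sigma>(1)] normal_law_second_moment[OF \<sigma>(1)])
  have "(\<integral>\<omega>. c \<bullet> W \<omega> \<partial>N) = (\<integral>x. x \<partial>normal_law 0 \<sigma>)"
    unfolding \<sigma>(2)[symmetric] by (subst integral_distr) simp_all
  then show "(\<integral>\<omega>. c \<bullet> W \<omega> \<partial>N) = 0"
    by (simp add: normal_law_mean[OF \<sigma>(1)])
  have "integrable (distr N borel (\<lambda>\<omega>. c \<bullet> W \<omega>)) (\<lambda>x. x\<^sup>2)"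
    unfolding \<sigma>(2) by (rule normal_law_integrable_square[OF \<sigma>(1)])
  then show "integrable N (\<lambda>\<omega>. (c \<bullet> W \<omega>)\<^sup>2)"
    by (subst (asm) integrable_distr_eq) simp_all
qed

text \<open>Joint laws are given only through scalar projections; square integrability of each projection
  is what makes products integrable.\<close>

lemma gaussian_integrable_product:
  assumes W: "centered_gaussian N W"
  shows "integrable N (\<lambda>\<omega>. (c \<bullet> W \<omega>) * (d \<bullet> W \<omega>))"
proof -
  have [measurable]: "W \<in> borel_measurable N"
    using W by (simp add: centered_gaussian_def)
  have "integrable N (\<lambda>\<omega>. (c \<bullet> W \<omega>)\<^sup>2 + (d \<bullet> W \<omega>)\<^sup>2)"
    by (intro Bochner_Integration.integrable_add gaussian_integrable_square[OF W])
  then show ?thesis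
  proof (rule Bochner_Integration.integrable_bound)
    have "\<bar>x * y\<bar> \<le> x\<^sup>2 + y\<^sup>2" for x y :: real
      using sum_squares_bound[of "\<bar>x\<bar>" "\<bar>y\<bar>"] abs_ge_zero[of "x * y"]
      unfolding power2_abs abs_mult mult.assoc by linarith
    then show "AE \<omega> in N. norm ((c \<bullet> W \<omega>) * (d \<bullet> W \<omega>)) \<le> norm ((c \<bullet> W \<omega>)\<^sup>2 + (d \<bullet> W \<omega>)\<^sup>2)"
      by simp
  qed measurable
qed

lemma inner_matrix: "(c :: real^'n^'m) \<bullet> W = (\<Sum>i\<in>UNIV. \<Sum>j\<in>UNIV. c $ i $ j * W $ i $ j)"
  by (simp add: inner_vec_def)

lemma matrix_entry_eq_inner: "(W :: real^'n^'m) $ i $ j = axis i (axis j 1) \<bullet> W"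
  by (simp add: inner_axis')

lemma gaussian_covariance:
  fixes W :: "'v \<Rightarrow> real^'n^'m"
  assumes W: "centered_gaussian N W"
  shows "covariance N (\<lambda>\<omega>. c \<bullet> W \<omega>) (\<lambda>\<omega>. d \<bullet> W \<omega>) =
    (\<Sum>i\<in>UNIV. \<Sum>j\<in>UNIV. \<Sum>k\<in>UNIV. \<Sum>l\<in>UNIV. c $ i $ j * d $ k $ l *
      covariance N (\<lambda>\<omega>. W \<omega> $ i $ j) (\<lambda>\<omega>. W \<omega> $ k $ l))"
proof -
  have entry: "integrable N (\<lambda>\<omega>. W \<omega> $ i $ j * W \<omega> $ k $ l)" for i j k l
    using gaussian_integrable_product[OF W, of "axis i (axis j 1)" "axis k (axis l 1)"]
    by (simp only: matrix_entry_eq_inner[symmetric])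
  have cov: "covariance N (\<lambda>\<omega>. W \<omega> $ i $ j) (\<lambda>\<omega>. W \<omega> $ k $ l) = (\<integral>\<omega>. W \<omega> $ i $ j * W \<omega> $ k $ l \<partial>N)" for i j k l
    unfolding covariance_def matrix_entry_eq_inner by (simp only: gaussian_mean[OF W] diff_0_right)
  have "covariance N (\<lambda>\<omega>. c \<bullet> W \<omega>) (\<lambda>\<omega>. d \<bullet> W \<omega>) = (\<integral>\<omega>. (c \<bullet> W \<omega>) * (d \<bullet> W \<omega>) \<partial>N)"
    by (simp add: covariance_def gaussian_mean[OF W])
  also have "\<dots> = (\<integral>\<omega>. (\<Sum>i\<in>UNIV. \<Sum>j\<in>UNIV. \<Sum>k\<in>UNIV. \<Sum>l\<in>UNIV.
      c $ i $ j * d $ k $ l * (W \<omega> $ i $ j * W \<omega> $ k $ l)) \<partial>N)"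
    unfolding inner_matrix sum_distrib_right unfolding sum_distrib_left by (simp only: mult_ac)
  also have "\<dots> = (\<Sum>i\<in>UNIV. \<Sum>j\<in>UNIV. \<Sum>k\<in>UNIV. \<Sum>l\<in>UNIV. c $ i $ j * d $ k $ l *
      covariance N (\<lambda>\<omega>. W \<omega> $ i $ j) (\<lambda>\<omega>. W \<omega> $ k $ l))"
    by (simp add: Bochner_Integration.integral_sum Bochner_Integration.integrable_sum entry cov)
  finally show ?thesis .
qed

section \<open>The Poisson equation of an irreducible stochastic matrix\<close>

lemma matpow_commute: "matpow A k ** A = A ** matpow A k"
  by (induction k) (simp_all add: matrix_mul_assoc[symmetric])

lemma matpow_nonneg:
  assumes "stochastic_matrix P"
  shows "0 \<le> matpow P k $ i $ j"
proof (induction k arbitrary: i j)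
  case (Suc k)
  then show ?case
    using assms by (auto simp: matrix_matrix_mult_def stochastic_matrix_def intro!: sum_nonneg)
qed (simp add: mat_def)

lemma harmonic_matpow:
  assumes "P *v h = h"
  shows "matpow P k *v h = (h :: real^'s)"
  by (induction k) (simp_all add: assms matrix_vector_mul_assoc[symmetric])

lemma stochastic_one: "stochastic_matrix P \<Longrightarrow> P *v 1 = (1 :: real^'s)"
  by (simp add: stochastic_matrix_def matrix_vector_mult_def vec_eq_iff)

text \<open>The maximum principle: at a state where \<open>h\<close> is maximal, the average of \<open>h\<close> over the states
  reachable in \<open>k\<close> steps equals the maximum, so \<open>h\<close> is maximal at each of them, and by
  irreducibility every state is reachable.\<close>

lemma harmonic_constant:
  fixes h :: "real^'s"
  assumes P: "stochastic_matrix P" "irreducible_matrix P" and h: "P *v h = h"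
  shows "\<exists>c. h = c *\<^sub>R 1"
proof -
  obtain i where i: "\<And>j. h $ j \<le> h $ i"
  proof -
    have "Max (range (($) h)) \<in> range (($) h)" by (intro Max_in) auto
    then obtain i where "h $ i = Max (range (($) h))" by force
    then have "h $ j \<le> h $ i" for j by simp
    then show ?thesis using that by blast
  qed
  have "h $ j = h $ i" for j
  proof -
    obtain k where k: "0 < matpow P k $ i $ j"
      using P(2) by (auto simp: irreducible_matrix_def)
    have "(\<Sum>l\<in>UNIV. matpow P k $ i $ l * h $ l) = h $ i"
      using arg_cong[OF harmonic_matpow[OF h, of k], of "\<lambda>v. v $ i"] by (simp add: matrix_vector_mult_def)
    moreover have "(\<Sum>l\<in>UNIV. matpow P k $ i $ l) = 1"
      using arg_cong[OF harmonic_matpow[OF stochastic_one[OF P(1)], of k], of "\<lambda>v. v $ i"]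
      by (simp add: matrix_vector_mult_def)
    ultimately have "(\<Sum>l\<in>UNIV. matpow P k $ i $ l * (h $ i - h $ l)) = 0"
      by (simp add: right_diff_distrib sum_subtractf sum_distrib_right[symmetric])
    then have "matpow P k $ i $ j * (h $ i - h $ j) = 0"
      using i matpow_nonneg[OF P(1)] by (subst (asm) sum_nonneg_eq_0_iff) auto
    then show ?thesis using k by simp
  qed
  then have "h = (h $ i) *\<^sub>R 1"
    by (simp add: vec_eq_iff)
  then show ?thesis ..
qed

lemma stationary_pos:
  assumes P: "stochastic_matrix P" "irreducible_matrix P" "stationary_vector P p"
  shows "0 < p $ j"
proof -
  obtain i where i: "0 < p $ i"
    using P(3) unfolding stationary_vector_def
    by (metis less_eq_real_def sum.neutral zero_neq_one)
  obtain k where k: "0 < matpow P k $ i $ j"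
    using P(2) by (auto simp: irreducible_matrix_def)
  have "p v* matpow P k = p"
    using P(3) by (induction k) (simp_all add: stationary_vector_def vector_matrix_mul_assoc[symmetric] vector_matrix_mul_rid)
  then have "p $ j = (\<Sum>l\<in>UNIV. matpow P k $ l $ j * p $ l)"
    by (metis (no_types, lifting) mult.commute sum.cong vec_lambda_beta vector_matrix_mult_def)
  moreover have "matpow P k $ i $ j * p $ i \<le> \<dots>"
    using P(3) matpow_nonneg[OF P(1)] by (intro member_le_sum) (auto simp: stationary_vector_def)
  ultimately show ?thesis using i k by (smt (verit) mult_pos_pos)
qed

text \<open>Adding the projection \<open>h \<mapsto> (p \<bullet> h) 1\<close> to \<open>I - P\<close> makes it injective, hence bijective: \<open>p\<close> is a
  left null vector of \<open>I - P\<close>, so a null vector of the sum has \<open>p \<bullet> h = 0\<close> and is harmonic, i.e.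
  constant. The preimage of \<open>f - (p \<bullet> f) 1\<close> satisfies \<open>p \<bullet> h = 0\<close> as well, and the projection
  drops out.\<close>

lemma poisson_equation:
  fixes f :: "real^'s"
  assumes P: "stochastic_matrix P" "irreducible_matrix P" "stationary_vector P p"
  shows "\<exists>h. h - P *v h = f - (p \<bullet> f) *\<^sub>R 1"
proof -
  have p1: "p \<bullet> 1 = 1" and pP: "p \<bullet> (P *v h) = p \<bullet> h" for h
    using P(3) unfolding dot_lmul_matrix[symmetric] by (simp_all add: stationary_vector_def inner_vec_def)
  define T where "T = (\<lambda>h. h - P *v h + (p \<bullet> h) *\<^sub>R 1)"
  have pT: "p \<bullet> T h = p \<bullet> h" for h
    by (simp add: T_def inner_add_right inner_diff_right pP p1)
  have lin: "linear T"
    unfolding T_def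
    by (intro linearI) (simp_all add: matrix_vector_right_distrib matrix_vector_mult_scaleR inner_add_right
        scaleR_add_left scaleR_diff_right scaleR_add_right)
  moreover have "inj T"
  proof (subst linear_inj_iff_eq_0[OF lin], intro allI impI)
    fix h assume "T h = 0"
    with pT[of h] have ph: "p \<bullet> h = 0" by simp
    with \<open>T h = 0\<close> have "P *v h = h" by (simp add: T_def)
    then obtain c where "h = c *\<^sub>R 1" using harmonic_constant[OF P(1,2)] by blast
    with ph p1 show "h = 0" by simp
  qed
  ultimately have "surj T"
    by (rule linear_inj_imp_surj)
  then obtain h where h: "T h = f - (p \<bullet> f) *\<^sub>R 1"
    by (metis surj_def)
  have "p \<bullet> h = 0"
    using pT[of h] by (simp add: h inner_diff_right p1)
  with h show ?thesis by (auto simp: T_def)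
qed

section \<open>Expectations along a finite Markov chain\<close>

text \<open>The functionals of the whole trajectory that are measurable with respect to the first \<open>t + 1\<close>
  states. As the state space is finite, such a functional takes finitely many values along the
  chain; measurability and integrability are then automatic, whatever its range.\<close>

definition determined_by :: "nat \<Rightarrow> ((nat \<Rightarrow> 's) \<Rightarrow> 'b) \<Rightarrow> bool" where
  "determined_by t F \<longleftrightarrow> (\<forall>x y. (\<forall>u\<le>t. x u = y u) \<longrightarrow> F x = F y)"

lemma determined_byI: "(\<And>x y. (\<And>u. u \<le> t \<Longrightarrow> x u = y u) \<Longrightarrow> F x = F y) \<Longrightarrow> determined_by t F"
  unfolding determined_by_def by blast

lemma determined_by_restrict: "determined_by t F \<Longrightarrow> F (restrict x {..t}) = F x"
  unfolding determined_by_def by (meson atMost_iff restrict_apply')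

locale finite_markov_chain =
  fixes M :: "'w measure" and P :: "real^'s^'s" and a :: "real^'s" and X :: "nat \<Rightarrow> 'w \<Rightarrow> 's::finite"
  assumes chain: "markov_chain M P a X"
begin

sublocale prob_space M
  using chain by (simp add: markov_chain_def)

abbreviation traj :: "'w \<Rightarrow> nat \<Rightarrow> 's" where
  "traj \<omega> \<equiv> (\<lambda>t. X t \<omega>)"

lemma measurable_X[measurable]: "X t \<in> measurable M (count_space UNIV)"
  using chain by (simp add: markov_chain_def)

definition paths :: "nat \<Rightarrow> (nat \<Rightarrow> 's) set" where
  "paths t = PiE {..t} (\<lambda>_. UNIV)"

definition follows :: "nat \<Rightarrow> (nat \<Rightarrow> 's) \<Rightarrow> 'w set" where
  "follows t x = {\<omega> \<in> space M. \<forall>u\<le>t. X u \<omega> = x u}"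

lemma finite_paths: "finite (paths t)"
  by (simp add: paths_def finite_PiE)

lemma follows_sets[measurable]: "follows t x \<in> sets M"
  unfolding follows_def by measurable

lemma follows_iff: "x \<in> paths t \<Longrightarrow> \<omega> \<in> space M \<Longrightarrow> \<omega> \<in> follows t x \<longleftrightarrow> x = restrict (traj \<omega>) {..t}"
  by (auto simp: paths_def follows_def PiE_def extensional_def restrict_def fun_eq_iff)

lemma restrict_traj_in_paths: "restrict (traj \<omega>) {..t} \<in> paths t"
  by (simp add: paths_def)

lemma measurable_determined:
  assumes F: "determined_by t F" and space: "\<And>x. F x \<in> space Q"
  shows "(\<lambda>\<omega>. F (traj \<omega>)) \<in> measurable M Q"
proof -
  have "(\<lambda>\<omega>. restrict (traj \<omega>) {..t}) \<in> measurable M (count_space (paths t))"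
  proof (subst measurable_count_space_eq2[OF finite_paths], intro conjI ballI)
    fix x assume "x \<in> paths t"
    then have "(\<lambda>\<omega>. restrict (traj \<omega>) {..t}) -` {x} \<inter> space M = follows t x"
      using follows_iff by (auto simp: follows_def)
    then show "(\<lambda>\<omega>. restrict (traj \<omega>) {..t}) -` {x} \<inter> space M \<in> sets M"
      by simp
  qed (simp add: restrict_traj_in_paths)
  moreover have "F \<in> measurable (count_space (paths t)) Q"
    using space by simp
  ultimately have "(\<lambda>\<omega>. F (restrict (traj \<omega>) {..t})) \<in> measurable M Q"
    by (rule measurable_compose)
  then show ?thesis
    using determined_by_restrict[OF F] by simp
qed

lemma determined_eq_sum:
  fixes F :: "(nat \<Rightarrow> 's) \<Rightarrow> 'b::real_normed_vector"
  assumes "determined_by t F" "\<omega> \<in> space M"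
  shows "F (traj \<omega>) = (\<Sum>x\<in>paths t. indicator (follows t x) \<omega> *\<^sub>R F x)"
proof -
  have "(\<Sum>x\<in>paths t. indicator (follows t x) \<omega> *\<^sub>R F x) =
      (\<Sum>x\<in>paths t. if x = restrict (traj \<omega>) {..t} then F x else 0)"
    by (intro sum.cong refl) (auto simp: follows_iff assms(2) indicator_def)
  then show ?thesis
    using determined_by_restrict[OF assms(1)] finite_paths restrict_traj_in_paths by simp
qed

lemma
  fixes c :: "'b::{banach, second_countable_topology}"
  assumes "A \<in> sets M"
  shows integrable_indicator_scaleR: "integrable M (\<lambda>\<omega>. indicator A \<omega> *\<^sub>R c)"
    and expectation_indicator_scaleR: "(\<integral>\<omega>. indicator A \<omega> *\<^sub>R c \<partial>M) = prob A *\<^sub>R c"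
proof -
  have i: "integrable M (indicator A :: 'w \<Rightarrow> real)"
    using assms by (intro integrable_real_indicator) (auto simp: less_top[symmetric])
  then show "integrable M (\<lambda>\<omega>. indicator A \<omega> *\<^sub>R c)"
    by (intro integrable_scaleR_left)
  show "(\<integral>\<omega>. indicator A \<omega> *\<^sub>R c \<partial>M) = prob A *\<^sub>R c"
    using i assms by (subst integral_scaleR_left) auto
qed

lemma
  fixes F :: "(nat \<Rightarrow> 's) \<Rightarrow> 'b::{banach, second_countable_topology}"
  assumes F: "determined_by t F"
  shows integrable_determined: "integrable M (\<lambda>\<omega>. F (traj \<omega>))"
    and expectation_determined:
      "(\<integral>\<omega>. F (traj \<omega>) \<partial>M) = (\<Sum>x\<in>paths t. prob (follows t x) *\<^sub>R F x)"
proof -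
  have i: "integrable M (\<lambda>\<omega>. indicator (follows t x) \<omega> *\<^sub>R F x)" for x
    by (intro integrable_indicator_scaleR follows_sets)
  have "integrable M (\<lambda>\<omega>. \<Sum>x\<in>paths t. indicator (follows t x) \<omega> *\<^sub>R F x)"
    by (intro Bochner_Integration.integrable_sum i)
  then show "integrable M (\<lambda>\<omega>. F (traj \<omega>))"
    by (rule Bochner_Integration.integrable_cong[THEN iffD1, rotated -1])
      (auto simp: determined_eq_sum[OF F])
  have "(\<integral>\<omega>. F (traj \<omega>) \<partial>M) = (\<integral>\<omega>. (\<Sum>x\<in>paths t. indicator (follows t x) \<omega> *\<^sub>R F x) \<partial>M)"
    by (intro Bochner_Integration.integral_cong refl determined_eq_sum F)
  also have "\<dots> = (\<Sum>x\<in>paths t. prob (follows t x) *\<^sub>R F x)"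
    by (subst Bochner_Integration.integral_sum[OF i]) (simp only: expectation_indicator_scaleR[OF follows_sets])
  finally show "(\<integral>\<omega>. F (traj \<omega>) \<partial>M) = (\<Sum>x\<in>paths t. prob (follows t x) *\<^sub>R F x)" .
qed

text \<open>The Markov property in product form, which also holds for paths of probability zero, on which
  the conditional probability says nothing.\<close>

lemma prob_follows_Suc:
  "prob (follows t x \<inter> {\<omega>\<in>space M. X (Suc t) \<omega> = j}) = prob (follows t x) * P $ x t $ j"
proof (cases "prob (follows t x) = 0")
  case True
  then have "prob (follows t x \<inter> {\<omega>\<in>space M. X (Suc t) \<omega> = j}) \<le> 0"
    using finite_measure_mono[OF _ follows_sets, of "follows t x \<inter> {\<omega>\<in>space M. X (Suc t) \<omega> = j}" t x] by auto
  then show ?thesis using True by (simp add: measure_le_0_iff)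
next
  case False
  then have pos: "prob (follows t x) > 0"
    by (simp add: zero_less_measure_iff)
  then have "\<P>(\<omega> in M. X (Suc t) \<omega> = j \<bar> \<forall>u\<le>t. X u \<omega> = x u) = P $ x t $ j"
    using chain by (auto simp: markov_chain_def follows_def)
  moreover have "{\<omega> \<in> space M. X (Suc t) \<omega> = j \<and> (\<forall>u\<le>t. X u \<omega> = x u)} =
      follows t x \<inter> {\<omega>\<in>space M. X (Suc t) \<omega> = j}"
    by (auto simp: follows_def)
  ultimately show ?thesis
    using pos by (simp add: cond_prob_def follows_def field_simps)
qed

text \<open>The next state may be averaged out given the past; this is the only form in which the Markov
  property is used.\<close>

lemma expectation_step:
  fixes F :: "(nat \<Rightarrow> 's) \<Rightarrow> 'b::{banach, second_countable_topology, real_normed_field}"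
  assumes F: "determined_by t F"
  shows "(\<integral>\<omega>. F (traj \<omega>) * g (X t \<omega>) (X (Suc t) \<omega>) \<partial>M) =
    (\<integral>\<omega>. F (traj \<omega>) * (\<Sum>j\<in>UNIV. of_real (P $ X t \<omega> $ j) * g (X t \<omega>) j) \<partial>M)"
proof -
  let ?E = "\<lambda>x j. follows t x \<inter> {\<omega>\<in>space M. X (Suc t) \<omega> = j}"
  have E[measurable]: "?E x j \<in> sets M" for x j
    by measurable
  have i: "integrable M (\<lambda>\<omega>. indicator (?E x j) \<omega> *\<^sub>R (F x * g (x t) j))" for x j
    by (intro integrable_indicator_scaleR E)
  have "(\<integral>\<omega>. F (traj \<omega>) * g (X t \<omega>) (X (Suc t) \<omega>) \<partial>M) =
      (\<integral>\<omega>. (\<Sum>j\<in>UNIV. \<Sum>x\<in>paths t. indicator (?E x j) \<omega> *\<^sub>R (F x * g (x t) j)) \<partial>M)"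
  proof (intro Bochner_Integration.integral_cong refl)
    fix \<omega> assume \<omega>: "\<omega> \<in> space M"
    have d: "determined_by t (\<lambda>x. F x * g (x t) j)" for j
      unfolding determined_by_def
    proof (intro allI impI)
      fix x y :: "nat \<Rightarrow> 's" assume xy: "\<forall>u\<le>t. x u = y u"
      then have "x t = y t" "F x = F y" using F unfolding determined_by_def by blast+
      then show "F x * g (x t) j = F y * g (y t) j" by simp
    qed
    have "(\<Sum>j\<in>UNIV. \<Sum>x\<in>paths t. indicator (?E x j) \<omega> *\<^sub>R (F x * g (x t) j)) =
       (\<Sum>j\<in>UNIV. if j = X (Suc t) \<omega> then (\<Sum>x\<in>paths t. indicator (follows t x) \<omega> *\<^sub>R (F x * g (x t) j)) else 0)"
    proof (intro sum.cong refl)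
      fix j show "(\<Sum>x\<in>paths t. indicator (?E x j) \<omega> *\<^sub>R (F x * g (x t) j)) =
        (if j = X (Suc t) \<omega> then (\<Sum>x\<in>paths t. indicator (follows t x) \<omega> *\<^sub>R (F x * g (x t) j)) else 0)"
        using \<omega> by (cases "j = X (Suc t) \<omega>") (simp_all add: indicator_def)
    qed
    also have "\<dots> = (\<Sum>j\<in>UNIV. if j = X (Suc t) \<omega> then F (traj \<omega>) * g (X t \<omega>) j else 0)"
      using determined_eq_sum[OF d \<omega>] by simp
    finally show "F (traj \<omega>) * g (X t \<omega>) (X (Suc t) \<omega>) =
      (\<Sum>j\<in>UNIV. \<Sum>x\<in>paths t. indicator (?E x j) \<omega> *\<^sub>R (F x * g (x t) j))"
      by simp
  qed
  also have "\<dots> = (\<Sum>j\<in>UNIV. \<Sum>x\<in>paths t. prob (?E x j) *\<^sub>R (F x * g (x t) j))"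
    by (subst Bochner_Integration.integral_sum, intro Bochner_Integration.integrable_sum i,
        subst Bochner_Integration.integral_sum, rule i)
      (simp only: expectation_indicator_scaleR[OF E])
  also have "\<dots> = (\<Sum>x\<in>paths t. prob (follows t x) *\<^sub>R (F x * (\<Sum>j\<in>UNIV. of_real (P $ x t $ j) * g (x t) j)))"
    by (subst sum.swap) (simp add: prob_follows_Suc sum_distrib_left scaleR_conv_of_real scaleR_sum_right mult_ac)
  also have "\<dots> = (\<integral>\<omega>. F (traj \<omega>) * (\<Sum>j\<in>UNIV. of_real (P $ X t \<omega> $ j) * g (X t \<omega>) j) \<partial>M)"
  proof (rule expectation_determined[symmetric], unfold determined_by_def, intro allI impI)
    fix x y :: "nat \<Rightarrow> 's" assume xy: "\<forall>u\<le>t. x u = y u"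
    then have "x t = y t" "F x = F y" using F unfolding determined_by_def by blast+
    then show "F x * (\<Sum>j\<in>UNIV. of_real (P $ x t $ j) * g (x t) j) =
        F y * (\<Sum>j\<in>UNIV. of_real (P $ y t $ j) * g (y t) j)" by simp
  qed
  finally show ?thesis .
qed

lemma expectation_X0: "(\<integral>\<omega>. h (X 0 \<omega>) \<partial>M) = (\<Sum>i\<in>UNIV. a $ i * h i)" for h :: "'s \<Rightarrow> real"
proof -
  have "(\<integral>\<omega>. h (X 0 \<omega>) \<partial>M) = (\<integral>\<omega>. (\<Sum>i\<in>UNIV. indicator {\<omega>\<in>space M. X 0 \<omega> = i} \<omega> * h i) \<partial>M)"
    by (intro Bochner_Integration.integral_cong refl) (simp add: indicator_def if_distrib[of "\<lambda>x. x * _"] cong: if_cong)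
  also have "\<dots> = (\<Sum>i\<in>UNIV. prob {\<omega>\<in>space M. X 0 \<omega> = i} * h i)"
    by (subst Bochner_Integration.integral_sum) (auto intro!: integrable_real_mult_indicator simp: less_top[symmetric])
  finally show ?thesis
    using chain by (simp add: markov_chain_def)
qed

lemma expectation_state: "(\<integral>\<omega>. h $ X t \<omega> \<partial>M) = (a v* matpow P t) \<bullet> h" for h :: "real^'s"
proof (induction t arbitrary: h)
  case 0
  show ?case
    by (simp add: expectation_X0[of "\<lambda>i. h $ i"] vector_matrix_mul_rid inner_vec_def)
next
  case (Suc t)
  have "(\<integral>\<omega>. h $ X (Suc t) \<omega> \<partial>M) = (\<integral>\<omega>. (P *v h) $ X t \<omega> \<partial>M)"
    using expectation_step[of t "\<lambda>_. 1::real" "\<lambda>_ j. h $ j"]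
    by (simp add: determined_by_def matrix_vector_mult_def)
  also have "\<dots> = (a v* matpow P t) \<bullet> (P *v h)"
    by (rule Suc.IH)
  also have "\<dots> = (a v* matpow P (Suc t)) \<bullet> h"
    by (simp add: dot_lmul_matrix matrix_vector_mul_assoc matpow_commute)
  finally show ?case .
qed

lemma availability_eq: "availability M X U k = (a v* matpow P k) \<bullet> indicator_vec U"
proof -
  have "availability M X U k = (\<integral>\<omega>. indicator {\<omega>\<in>space M. X k \<omega> \<in> U} \<omega> \<partial>M)"
    unfolding availability_def by simp
  also have "\<dots> = (\<integral>\<omega>. indicator_vec U $ X k \<omega> \<partial>M)"
    by (intro Bochner_Integration.integral_cong refl) (simp add: indicator_vec_def indicator_def)
  finally show ?thesis
    by (simp add: expectation_state)
qed

end

section \<open>A central limit theorem for sums over transitions\<close>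

definition path_sum :: "('s \<Rightarrow> 's \<Rightarrow> real) \<Rightarrow> nat \<Rightarrow> (nat \<Rightarrow> 's) \<Rightarrow> real" where
  "path_sum g n x = (\<Sum>t<n. g (x t) (x (Suc t)))"

lemma path_sum_Suc: "path_sum g (Suc n) x = path_sum g n x + g (x n) (x (Suc n))"
  by (simp add: path_sum_def)

lemma determined_by_path_sum: "determined_by n (path_sum g n)"
  by (rule determined_byI) (auto simp: path_sum_def intro!: sum.cong)

lemma determined_by_comp: "determined_by t F \<Longrightarrow> determined_by t (\<lambda>x. k (F x))"
  unfolding determined_by_def by metis

lemma determined_by_state: "determined_by t (\<lambda>x. x t)"
  by (rule determined_byI) simp

lemma determined_by_comp2:
  "determined_by t F \<Longrightarrow> determined_by t G \<Longrightarrow> determined_by t (\<lambda>x. k (F x) (G x))"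
  unfolding determined_by_def by metis

lemma finite_function_bound: "\<exists>B\<ge>(1::real). \<forall>x. \<bar>f x\<bar> \<le> B" for f :: "'a::finite \<Rightarrow> real"
proof -
  have "\<bar>f x\<bar> \<le> max 1 (Max (range (\<lambda>x. \<bar>f x\<bar>)))" for x
    by (simp add: le_max_iff_disj)
  then show ?thesis by (intro exI[of _ "max 1 (Max (range (\<lambda>x. \<bar>f x\<bar>)))"]) simp
qed

text \<open>Expand \<open>exp(i \<theta> g)\<close> to second order in the first factor and to order zero where it is multiplied
  by \<open>\<theta>^2 h\<close>. The linear term vanishes because \<open>g\<close> is centred. Up to sign, the terms of order
  \<open>\<theta>^2 / 2\<close> are \<open>v + P h\<close> from the sum, with \<open>v\<close> the conditional variance, and \<open>s + h\<close> from the
  product; the Poisson equation makes them equal. The remaining fourth-order term \<open>\<theta>^4 s h / 4\<close> is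
  absorbed in the bound.\<close>

lemma one_step_error:
  fixes g :: "'s::finite \<Rightarrow> 's \<Rightarrow> real" and h :: "'s \<Rightarrow> real"
  assumes P: "stochastic_matrix P"
    and centered: "\<And>i. (\<Sum>j\<in>UNIV. P $ i $ j * g i j) = 0"
    and poisson: "\<And>i. h i - (\<Sum>j\<in>UNIV. P $ i $ j * h j) = (\<Sum>j\<in>UNIV. P $ i $ j * (g i j)\<^sup>2) - s"
    and B: "1 \<le> B" "\<And>i j. \<bar>g i j\<bar> \<le> B" "\<And>i. \<bar>h i\<bar> \<le> B" "\<bar>s\<bar> \<le> B"
    and \<theta>: "0 \<le> \<theta>" "\<theta> \<le> 1"
  shows "cmod ((\<Sum>j\<in>UNIV. of_real (P $ i $ j) * (iexp (\<theta> * g i j) * of_real (1 - \<theta>\<^sup>2 / 2 * h j))) -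
      of_real (1 - \<theta>\<^sup>2 / 2 * s) * of_real (1 - \<theta>\<^sup>2 / 2 * h i)) \<le> 2 * B ^ 3 * \<theta> ^ 3"
proof -
  let ?a = "\<lambda>j. \<theta> * g i j"
  let ?main = "\<lambda>j. 1 + \<i> * ?a j - of_real ((?a j)\<^sup>2 / 2) - of_real (\<theta>\<^sup>2 / 2 * h j)"
  define E where "E = (\<lambda>j. iexp (?a j) * of_real (1 - \<theta>\<^sup>2 / 2 * h j) - ?main j)"
  have E_bound: "cmod (E j) \<le> B ^ 3 * \<theta> ^ 3" for j
  proof -
    have a: "\<bar>?a j\<bar> \<le> B * \<theta>"
      using mult_right_mono[OF B(2)[of i j] \<theta>(1)] \<theta> by (simp add: abs_mult mult.commute)
    have 1: "cmod (iexp (?a j) - (1 + \<i> * ?a j - of_real ((?a j)\<^sup>2 / 2))) \<le> \<bar>?a j\<bar> ^ 3 / 6"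
      using iexp_approx1[of "?a j" 2]
      by (simp add: numeral_eq_Suc power_mult_distrib fact_numeral algebra_simps)
    have 2: "cmod (iexp (?a j) - 1) \<le> \<bar>?a j\<bar>"
      using iexp_approx1[of "?a j" 0] by simp
    have eq: "E j = (iexp (?a j) - (1 + \<i> * ?a j - of_real ((?a j)\<^sup>2 / 2)))
        - of_real (\<theta>\<^sup>2 / 2 * h j) * (iexp (?a j) - 1)"
    proof -
      have "e * (1 - w) - (m - w) = (e - m) - w * (e - 1)" for e w m :: complex
        by (simp add: algebra_simps)
      then show ?thesis unfolding E_def of_real_diff of_real_1 by blast
    qed
    have "cmod (E j) \<le> \<bar>?a j\<bar> ^ 3 / 6 + \<bar>\<theta>\<^sup>2 / 2 * h j\<bar> * \<bar>?a j\<bar>"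
      unfolding eq using 1 mult_left_mono[OF 2 abs_ge_zero[of "\<theta>\<^sup>2 / 2 * h j"]]
      by - (rule order_trans[OF norm_triangle_ineq4], rule add_mono, simp_all only: norm_mult norm_of_real)
    also have "\<dots> \<le> (B * \<theta>) ^ 3 / 6 + (\<theta>\<^sup>2 / 2 * B) * (B * \<theta>)"
      using a B \<theta> by (intro add_mono mult_mono divide_right_mono power_mono) (auto simp: abs_mult mult_left_mono)
    also have "\<dots> = B ^ 3 * \<theta> ^ 3 / 6 + B\<^sup>2 * \<theta> ^ 3 / 2"
      by (simp add: power_mult_distrib power2_eq_square power3_eq_cube mult_ac)
    also have "\<dots> \<le> B ^ 3 * \<theta> ^ 3 / 6 + B ^ 3 * \<theta> ^ 3 / 2"
      using B(1) \<theta> by (intro add_mono divide_right_mono mult_right_mono power_increasing) auto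
    also have "\<dots> \<le> B ^ 3 * \<theta> ^ 3"
      using B \<theta> by simp
    finally show ?thesis .
  qed
  have P1: "(\<Sum>j\<in>UNIV. P $ i $ j) = 1" and P0: "\<And>j. 0 \<le> P $ i $ j"
    using P by (auto simp: stochastic_matrix_def)
  have re: "(\<Sum>j\<in>UNIV. P $ i $ j * (1 - (?a j)\<^sup>2 / 2 - \<theta>\<^sup>2 / 2 * h j)) =
      1 - \<theta>\<^sup>2 / 2 * s - \<theta>\<^sup>2 / 2 * h i"
  proof -
    have "(\<Sum>j\<in>UNIV. P $ i $ j * (1 - (?a j)\<^sup>2 / 2 - \<theta>\<^sup>2 / 2 * h j)) =
       (\<Sum>j\<in>UNIV. P $ i $ j) - \<theta>\<^sup>2 / 2 * (\<Sum>j\<in>UNIV. P $ i $ j * (g i j)\<^sup>2) - \<theta>\<^sup>2 / 2 * (\<Sum>j\<in>UNIV. P $ i $ j * h j)"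
      by (simp add: sum_distrib_left sum_subtractf[symmetric] power_mult_distrib algebra_simps)
    also have "\<dots> = 1 - \<theta>\<^sup>2 / 2 * ((\<Sum>j\<in>UNIV. P $ i $ j * (g i j)\<^sup>2) + (\<Sum>j\<in>UNIV. P $ i $ j * h j))"
      by (simp only: P1 distrib_left diff_diff_eq)
    also have "(\<Sum>j\<in>UNIV. P $ i $ j * (g i j)\<^sup>2) + (\<Sum>j\<in>UNIV. P $ i $ j * h j) = s + h i"
      using poisson[of i] by linarith
    finally show ?thesis
      by (simp only: distrib_left diff_diff_eq)
  qed
  have im: "(\<Sum>j\<in>UNIV. P $ i $ j * ?a j) = 0"
    using centered[of i] by (simp add: mult.left_commute[of _ \<theta>] sum_distrib_left[symmetric])
  have "(\<Sum>j\<in>UNIV. of_real (P $ i $ j) * ?main j) =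
      of_real (\<Sum>j\<in>UNIV. P $ i $ j * (1 - (?a j)\<^sup>2 / 2 - \<theta>\<^sup>2 / 2 * h j)) + \<i> * of_real (\<Sum>j\<in>UNIV. P $ i $ j * ?a j)"
    by (simp add: sum_distrib_left sum.distrib[symmetric] algebra_simps)
  then have main: "(\<Sum>j\<in>UNIV. of_real (P $ i $ j) * ?main j) = complex_of_real (1 - \<theta>\<^sup>2 / 2 * s - \<theta>\<^sup>2 / 2 * h i)"
    unfolding re im by simp
  have split: "(\<Sum>j\<in>UNIV. of_real (P $ i $ j) * (iexp (?a j) * of_real (1 - \<theta>\<^sup>2 / 2 * h j))) =
      (\<Sum>j\<in>UNIV. of_real (P $ i $ j) * ?main j) + (\<Sum>j\<in>UNIV. of_real (P $ i $ j) * E j)"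
    by (simp add: E_def sum.distrib[symmetric] distrib_left[symmetric])
  have eq: "(\<Sum>j\<in>UNIV. of_real (P $ i $ j) * (iexp (?a j) * of_real (1 - \<theta>\<^sup>2 / 2 * h j))) -
      of_real (1 - \<theta>\<^sup>2 / 2 * s) * of_real (1 - \<theta>\<^sup>2 / 2 * h i) =
      (\<Sum>j\<in>UNIV. of_real (P $ i $ j) * E j) - complex_of_real (\<theta> ^ 4 / 4 * (s * h i))"
  proof -
    have "(1 - \<theta>\<^sup>2 / 2 * s) * (1 - \<theta>\<^sup>2 / 2 * h i) =
        (1 - \<theta>\<^sup>2 / 2 * s - \<theta>\<^sup>2 / 2 * h i) + \<theta> ^ 4 / 4 * (s * h i)"
      by (simp add: algebra_simps power2_eq_square power4_eq_xxxx)
    then have "complex_of_real (1 - \<theta>\<^sup>2 / 2 * s) * of_real (1 - \<theta>\<^sup>2 / 2 * h i) =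
        of_real (1 - \<theta>\<^sup>2 / 2 * s - \<theta>\<^sup>2 / 2 * h i) + of_real (\<theta> ^ 4 / 4 * (s * h i))"
      unfolding of_real_mult[symmetric] of_real_add[symmetric] by (rule arg_cong)
    with split show ?thesis unfolding main by simp
  qed
  have "cmod (\<Sum>j\<in>UNIV. of_real (P $ i $ j) * E j) \<le> (\<Sum>j\<in>UNIV. P $ i $ j * (B ^ 3 * \<theta> ^ 3))"
    using E_bound P0 by (intro sum_norm_le) (auto simp: norm_mult intro!: mult_left_mono)
  then have 1: "cmod (\<Sum>j\<in>UNIV. of_real (P $ i $ j) * E j) \<le> B ^ 3 * \<theta> ^ 3"
    by (simp add: sum_distrib_right[symmetric] P1)
  have "\<theta> ^ 4 / 4 \<le> \<theta> ^ 3"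
    using \<theta> power_decreasing[of 3 4 \<theta>] zero_le_power[OF \<theta>(1), of 3] zero_le_power[OF \<theta>(1), of 4]
    by linarith
  then have "\<bar>\<theta> ^ 4 / 4 * (s * h i)\<bar> \<le> \<theta> ^ 3 * (B * B)"
    using B \<theta> unfolding abs_mult
    by (intro mult_mono) auto
  also have "\<dots> \<le> B ^ 3 * \<theta> ^ 3"
    using mult_right_mono[OF power_increasing[of 2 3 B], of "\<theta> ^ 3"] B \<theta>
    by (simp add: power2_eq_square mult.commute)
  finally have 2: "cmod (complex_of_real (\<theta> ^ 4 / 4 * (s * h i))) \<le> B ^ 3 * \<theta> ^ 3"
    by (simp only: norm_of_real)
  show ?thesis
    unfolding eq by (rule order_trans[OF norm_triangle_ineq4]) (use 1 2 in linarith)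
qed

locale ergodic_chain = finite_markov_chain M P a X
  for M :: "'w measure" and P :: "real^'s^'s" and a :: "real^'s" and X :: "nat \<Rightarrow> 'w \<Rightarrow> 's::finite" +
  fixes \<pi> :: "real^'s"
  assumes stochastic: "stochastic_matrix P"
    and irreducible: "irreducible_matrix P"
    and stationary: "stationary_vector P \<pi>"
begin

definition centered :: "('s \<Rightarrow> 's \<Rightarrow> real) \<Rightarrow> bool" where
  "centered g \<longleftrightarrow> (\<forall>i. (\<Sum>j\<in>UNIV. P $ i $ j * g i j) = 0)"

text \<open>The stationary mean of the conditional variance of one summand, for a centred \<open>g\<close>.\<close>

definition asymptotic_variance :: "('s \<Rightarrow> 's \<Rightarrow> real) \<Rightarrow> real" where
  "asymptotic_variance g = (\<Sum>i\<in>UNIV. \<pi> $ i * (\<Sum>j\<in>UNIV. P $ i $ j * (g i j)\<^sup>2))"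

lemma asymptotic_variance_nonneg: "0 \<le> asymptotic_variance g"
  using stochastic stationary unfolding asymptotic_variance_def
  by (intro sum_nonneg mult_nonneg_nonneg) (auto simp: stochastic_matrix_def stationary_vector_def)

lemma poisson_function:
  "\<exists>h. \<forall>i. h i - (\<Sum>j\<in>UNIV. P $ i $ j * h j) = f i - (\<Sum>j\<in>UNIV. \<pi> $ j * f j)"
proof -
  obtain h :: "real^'s" where h: "h - P *v h = (\<chi> i. f i) - (\<pi> \<bullet> (\<chi> i. f i)) *\<^sub>R 1"
    using poisson_equation[OF stochastic irreducible stationary] by blast
  have "h $ i - (\<Sum>j\<in>UNIV. P $ i $ j * h $ j) = f i - (\<Sum>j\<in>UNIV. \<pi> $ j * f j)" for i
    using arg_cong[OF h, of "\<lambda>v. v $ i"] by (simp add: matrix_vector_mult_def inner_vec_def)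
  then show ?thesis by blast
qed

text \<open>Martingale differences are orthogonal: the cross term vanishes by averaging out the last
  transition.\<close>

lemma second_moment_path_sum:
  assumes g: "centered g" and B: "\<And>i j. \<bar>g i j\<bar> \<le> B"
  shows "(\<integral>\<omega>. (path_sum g n (traj \<omega>))\<^sup>2 \<partial>M) \<le> n * B\<^sup>2"
proof (induction n)
  case 0
  show ?case by (simp add: path_sum_def)
next
  case (Suc n)
  let ?S = "\<lambda>\<omega>. path_sum g n (traj \<omega>)" and ?\<xi> = "\<lambda>\<omega>. g (X n \<omega>) (X (Suc n) \<omega>)"
  have i2: "integrable M (\<lambda>\<omega>. (?S \<omega>)\<^sup>2)"
    by (rule integrable_determined[of n "\<lambda>x. (path_sum g n x)\<^sup>2"])
      (rule determined_by_comp[OF determined_by_path_sum])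
  have i\<xi>: "integrable M (\<lambda>\<omega>. (?\<xi> \<omega>)\<^sup>2)"
    by (rule integrable_determined[of "Suc n" "\<lambda>x. (g (x n) (x (Suc n)))\<^sup>2"]) (rule determined_byI, simp)
  have iS\<xi>: "integrable M (\<lambda>\<omega>. ?S \<omega> * ?\<xi> \<omega>)"
  proof (rule integrable_determined[of "Suc n" "\<lambda>x. path_sum g n x * g (x n) (x (Suc n))"])
    show "determined_by (Suc n) (\<lambda>x. path_sum g n x * g (x n) (x (Suc n)))"
      by (rule determined_byI) (auto simp: path_sum_def intro!: sum.cong)
  qed
  have cross: "(\<integral>\<omega>. ?S \<omega> * ?\<xi> \<omega> \<partial>M) = 0"
    using expectation_step[OF determined_by_path_sum, of g n g] g by (simp add: centered_def)
  have "(\<integral>\<omega>. (path_sum g (Suc n) (traj \<omega>))\<^sup>2 \<partial>M) =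
      (\<integral>\<omega>. (?S \<omega>)\<^sup>2 + 2 * (?S \<omega> * ?\<xi> \<omega>) + (?\<xi> \<omega>)\<^sup>2 \<partial>M)"
    by (simp add: path_sum_Suc power2_sum algebra_simps)
  also have "\<dots> = (\<integral>\<omega>. (?S \<omega>)\<^sup>2 \<partial>M) + (\<integral>\<omega>. (?\<xi> \<omega>)\<^sup>2 \<partial>M)"
    using i2 i\<xi> iS\<xi> cross by simp
  also have "(\<integral>\<omega>. (?\<xi> \<omega>)\<^sup>2 \<partial>M) \<le> (\<integral>\<omega>. B\<^sup>2 \<partial>M)"
    using i\<xi> B by (intro integral_mono) (auto simp: abs_le_square_iff[symmetric] intro: order_trans[OF _ abs_ge_self])
  also have "\<dots> = B\<^sup>2" by (simp add: prob_space)
  finally show ?case using Suc.IH by (simp add: algebra_simps)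
qed

lemma first_moment_path_sum:
  assumes g: "centered g" and B: "\<And>i j. \<bar>g i j\<bar> \<le> B"
  shows "(\<integral>\<omega>. \<bar>path_sum g n (traj \<omega>)\<bar> \<partial>M) \<le> sqrt n * (1 + B\<^sup>2)"
proof (cases "n = 0")
  case True
  then show ?thesis by (simp add: path_sum_def)
next
  case False
  define c where "c = sqrt n"
  have c: "c > 0" "c * c = n" using False by (auto simp: c_def)
  let ?S = "\<lambda>\<omega>. path_sum g n (traj \<omega>)"
  have i2: "integrable M (\<lambda>\<omega>. (?S \<omega>)\<^sup>2)"
    by (rule integrable_determined[of n "\<lambda>x. (path_sum g n x)\<^sup>2"])
      (rule determined_by_comp[OF determined_by_path_sum])
  have i1: "integrable M (\<lambda>\<omega>. \<bar>?S \<omega>\<bar>)"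
    by (rule integrable_determined[of n "\<lambda>x. \<bar>path_sum g n x\<bar>"])
      (rule determined_by_comp[OF determined_by_path_sum])
  \<comment> \<open>integrated, this bounds the first moment by the second; the two terms balance at \<open>c = sqrt n\<close>\<close>
  have am: "\<bar>x\<bar> \<le> c + x\<^sup>2 / c" for x
  proof (cases "\<bar>x\<bar> \<le> c")
    case False
    then have "\<bar>x\<bar> * c \<le> \<bar>x\<bar> * \<bar>x\<bar>"
      by (intro mult_left_mono) auto
    then have "\<bar>x\<bar> * c \<le> x\<^sup>2"
      by (simp add: power2_eq_square)
    then have "\<bar>x\<bar> \<le> x\<^sup>2 / c" using c by (simp add: field_simps)
    then show ?thesis using c by linarith
  next
    case True
    moreover have "0 \<le> x\<^sup>2 / c" using c by simp
    ultimately show ?thesis by linarith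
  qed
  have "(\<integral>\<omega>. \<bar>?S \<omega>\<bar> \<partial>M) \<le> (\<integral>\<omega>. c + (?S \<omega>)\<^sup>2 / c \<partial>M)"
    using i1 i2 am by (intro integral_mono) auto
  also have "\<dots> = c + (\<integral>\<omega>. (?S \<omega>)\<^sup>2 \<partial>M) / c"
    using i2 by (simp add: prob_space)
  also have "\<dots> \<le> c + n * B\<^sup>2 / c"
    using second_moment_path_sum[OF g B, of n] c by (intro add_left_mono divide_right_mono) auto
  also have "\<dots> = sqrt n * (1 + B\<^sup>2)"
    using c by (simp add: c_def[symmetric] c(2)[symmetric] field_simps)
  finally show ?thesis .
qed

text \<open>With \<open>\<theta> = 1 / sqrt n\<close>, the corrected characteristic function \<open>\<psi>\<close> contracts by the same factor in
  every step up to \<open>O(\<theta>^3)\<close>, so that after \<open>n\<close> steps it is \<open>(1 - s / (2 n))^n\<close> up to \<open>O(1 / sqrt n)\<close>.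
  The correction itself is of size \<open>O(\<theta>^2)\<close>.\<close>

lemma clt_path_sum:
  assumes g: "centered g"
  shows "(\<lambda>n. \<integral>\<omega>. iexp (path_sum g n (traj \<omega>) / sqrt n) \<partial>M) \<longlonglongrightarrow> exp (- asymptotic_variance g / 2)"
proof -
  define s where "s = asymptotic_variance g"
  have s: "0 \<le> s" by (simp add: s_def asymptotic_variance_nonneg)
  obtain h where h: "\<And>i. h i - (\<Sum>j\<in>UNIV. P $ i $ j * h j) = (\<Sum>j\<in>UNIV. P $ i $ j * (g i j)\<^sup>2) - s"
    using poisson_function[of "\<lambda>i. \<Sum>j\<in>UNIV. P $ i $ j * (g i j)\<^sup>2"] unfolding s_def asymptotic_variance_def by blast
  obtain B1 where B1: "1 \<le> B1" "\<And>z. \<bar>case_prod g z\<bar> \<le> B1"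
    using finite_function_bound[of "case_prod g"] by blast
  obtain B2 where B2: "1 \<le> B2" "\<And>i. \<bar>h i\<bar> \<le> B2"
    using finite_function_bound[of h] by blast
  define B where "B = B1 + B2 + s"
  have B: "1 \<le> B" "\<And>i j. \<bar>g i j\<bar> \<le> B" "\<And>i. \<bar>h i\<bar> \<le> B" "\<bar>s\<bar> \<le> B"
    using B1(1) B1(2)[of "(_, _)"] B2 s unfolding B_def by (auto intro: add_increasing2 simp: add_increasing add_increasing2)
  define \<psi> where "\<psi> = (\<lambda>\<theta> t. \<integral>\<omega>. iexp (\<theta> * path_sum g t (traj \<omega>)) * of_real (1 - \<theta>\<^sup>2 / 2 * h (X t \<omega>)) \<partial>M)"
  have det: "determined_by t (\<lambda>x. iexp (\<theta> * path_sum g t x))" for t \<theta>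
    by (rule determined_by_comp[OF determined_by_path_sum])
  have det2: "determined_by t (\<lambda>x. iexp (\<theta> * path_sum g t x) * k (x t))" for t \<theta> and k :: "'s \<Rightarrow> complex"
    by (rule determined_by_comp2[OF det determined_by_comp[OF determined_by_state]])
  have int: "integrable M (\<lambda>\<omega>. iexp (\<theta> * path_sum g t (traj \<omega>)) * k (X t \<omega>))" for t \<theta> and k :: "'s \<Rightarrow> complex"
    by (rule integrable_determined[OF det2])
  have small: "cmod (\<integral>\<omega>. iexp (\<theta> * path_sum g t (traj \<omega>)) * k (X t \<omega>) \<partial>M) \<le> b"
    if k: "\<And>i. cmod (k i) \<le> b" for t \<theta> b and k :: "'s \<Rightarrow> complex"
  proof -
    have "cmod (\<integral>\<omega>. iexp (\<theta> * path_sum g t (traj \<omega>)) * k (X t \<omega>) \<partial>M) \<le>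
        (\<integral>\<omega>. cmod (iexp (\<theta> * path_sum g t (traj \<omega>)) * k (X t \<omega>)) \<partial>M)"
      by (rule integral_norm_bound)
    also have "\<dots> \<le> (\<integral>\<omega>. b \<partial>M)"
      using integrable_norm[OF int[of \<theta> t k]] by (rule integral_mono) (simp_all add: norm_mult k)
    finally show ?thesis by (simp add: prob_space)
  qed
  have step: "cmod (\<psi> \<theta> (Suc t) - of_real (1 - \<theta>\<^sup>2 / 2 * s) * \<psi> \<theta> t) \<le> 2 * B ^ 3 * \<theta> ^ 3"
    if \<theta>: "0 \<le> \<theta>" "\<theta> \<le> 1" for \<theta> t
  proof -
    define q where "q = complex_of_real (1 - \<theta>\<^sup>2 / 2 * s)"
    define r where "r = (\<lambda>i. complex_of_real (1 - \<theta>\<^sup>2 / 2 * h i))"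
    define K where "K = (\<lambda>i. \<Sum>j\<in>UNIV. of_real (P $ i $ j) * (iexp (\<theta> * g i j) * r j))"
    let ?e = "\<lambda>\<omega>. iexp (\<theta> * path_sum g t (traj \<omega>))"
    have K: "cmod (K i - q * r i) \<le> 2 * B ^ 3 * \<theta> ^ 3" for i
      using one_step_error[OF stochastic _ h B \<theta>, of i] g unfolding centered_def K_def q_def r_def by blast
    have "\<psi> \<theta> (Suc t) = (\<integral>\<omega>. ?e \<omega> * (iexp (\<theta> * g (X t \<omega>) (X (Suc t) \<omega>)) * r (X (Suc t) \<omega>)) \<partial>M)"
      unfolding \<psi>_def path_sum_Suc r_def by (simp only: distrib_left of_real_add exp_add mult.assoc)
    also have "\<dots> = (\<integral>\<omega>. ?e \<omega> * K (X t \<omega>) \<partial>M)"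
      unfolding K_def by (rule expectation_step[OF det, of \<theta> t "\<lambda>i j. iexp (\<theta> * g i j) * r j"])
    finally have 1: "\<psi> \<theta> (Suc t) = (\<integral>\<omega>. ?e \<omega> * K (X t \<omega>) \<partial>M)" .
    have "(\<integral>\<omega>. ?e \<omega> * (q * r (X t \<omega>)) \<partial>M) = (\<integral>\<omega>. q * (?e \<omega> * r (X t \<omega>)) \<partial>M)"
      by (rule Bochner_Integration.integral_cong[OF refl]) (rule mult.left_commute)
    also have "\<dots> = q * \<psi> \<theta> t"
      unfolding \<psi>_def r_def by (rule integral_mult_right_zero)
    finally have 2: "q * \<psi> \<theta> t = (\<integral>\<omega>. ?e \<omega> * (q * r (X t \<omega>)) \<partial>M)" by (rule sym)
    have "\<psi> \<theta> (Suc t) - q * \<psi> \<theta> t = (\<integral>\<omega>. ?e \<omega> * K (X t \<omega>) - ?e \<omega> * (q * r (X t \<omega>)) \<partial>M)"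
      unfolding 1 2 using int[of \<theta> t K] int[of \<theta> t "\<lambda>i. q * r i"]
      by (rule Bochner_Integration.integral_diff[symmetric])
    also have "\<dots> = (\<integral>\<omega>. ?e \<omega> * (K (X t \<omega>) - q * r (X t \<omega>)) \<partial>M)"
      by (simp only: right_diff_distrib)
    also have "cmod \<dots> \<le> 2 * B ^ 3 * \<theta> ^ 3"
      by (rule small[of "\<lambda>i. K i - q * r i", OF K])
    finally show ?thesis unfolding q_def .
  qed
  \<comment> \<open>the factor has modulus at most \<open>1\<close>, so the errors of the single steps merely add up\<close>
  have iterate: "cmod (\<psi> \<theta> t - of_real ((1 - \<theta>\<^sup>2 / 2 * s) ^ t) * \<psi> \<theta> 0) \<le> t * (2 * B ^ 3 * \<theta> ^ 3)"
    if \<theta>: "0 \<le> \<theta>" "\<theta> \<le> 1" "\<theta>\<^sup>2 / 2 * s \<le> 1" for \<theta> t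
  proof (induction t)
    case (Suc t)
    let ?q = "1 - \<theta>\<^sup>2 / 2 * s"
    have q: "\<bar>?q\<bar> \<le> 1" using \<theta> s by (simp add: abs_le_iff)
    have "\<psi> \<theta> (Suc t) - of_real (?q ^ Suc t) * \<psi> \<theta> 0 =
        (\<psi> \<theta> (Suc t) - of_real ?q * \<psi> \<theta> t) + of_real ?q * (\<psi> \<theta> t - of_real (?q ^ t) * \<psi> \<theta> 0)"
      by (simp only: power_Suc of_real_mult) (simp only: right_diff_distrib mult.assoc add_diff_eq diff_add_cancel)
    also have "cmod \<dots> \<le> 2 * B ^ 3 * \<theta> ^ 3 + 1 * (t * (2 * B ^ 3 * \<theta> ^ 3))"
    proof (intro norm_triangle_le add_mono step \<theta>)
      show "cmod (of_real ?q * (\<psi> \<theta> t - of_real (?q ^ t) * \<psi> \<theta> 0)) \<le> 1 * (t * (2 * B ^ 3 * \<theta> ^ 3))"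
        unfolding norm_mult norm_of_real using Suc.IH q by (intro mult_mono) simp_all
    qed
    finally show ?case by (simp add: algebra_simps)
  qed simp
  have near: "cmod (\<psi> \<theta> t - (\<integral>\<omega>. iexp (\<theta> * path_sum g t (traj \<omega>)) \<partial>M)) \<le> \<theta>\<^sup>2 * B" for \<theta> t
  proof -
    let ?e = "\<lambda>\<omega>. iexp (\<theta> * path_sum g t (traj \<omega>))"
    have "\<psi> \<theta> t - (\<integral>\<omega>. ?e \<omega> * 1 \<partial>M) = (\<integral>\<omega>. ?e \<omega> * of_real (1 - \<theta>\<^sup>2 / 2 * h (X t \<omega>)) - ?e \<omega> * 1 \<partial>M)"
      unfolding \<psi>_def using int[of \<theta> t "\<lambda>i. of_real (1 - \<theta>\<^sup>2 / 2 * h i)"] int[of \<theta> t "\<lambda>_. 1"]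
      by (rule Bochner_Integration.integral_diff[symmetric])
    also have "\<dots> = (\<integral>\<omega>. ?e \<omega> * (of_real (1 - \<theta>\<^sup>2 / 2 * h (X t \<omega>)) - 1) \<partial>M)"
      by (simp only: right_diff_distrib)
    also have "cmod \<dots> \<le> \<theta>\<^sup>2 * B"
    proof (rule small[of "\<lambda>i. of_real (1 - \<theta>\<^sup>2 / 2 * h i) - 1"])
      fix i
      have "cmod (of_real (1 - \<theta>\<^sup>2 / 2 * h i) - 1) = \<theta>\<^sup>2 / 2 * \<bar>h i\<bar>"
        by (simp add: abs_mult norm_mult norm_power)
      also have "\<dots> \<le> \<theta>\<^sup>2 * B"
        using B(3)[of i] by (intro mult_mono) auto
      finally show "cmod (of_real (1 - \<theta>\<^sup>2 / 2 * h i) - 1) \<le> \<theta>\<^sup>2 * B" .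
    qed
    finally show ?thesis by simp
  qed
  define \<phi> where "\<phi> = (\<lambda>n::nat. \<integral>\<omega>. iexp (path_sum g n (traj \<omega>) / sqrt n) \<partial>M)"
  have bound: "cmod (\<phi> n - of_real ((1 + (- s / 2) / n) ^ n)) \<le> 2 * B ^ 3 / sqrt n + 2 * B / n"
    if n: "1 \<le> n" "s \<le> n" for n :: nat
  proof -
    \<comment> \<open>the condition \<open>s \<le> n\<close> ensures that the contraction factor lies in \<open>[0, 1]\<close>\<close>
    define \<theta> where "\<theta> = 1 / sqrt n"
    have \<theta>2: "\<theta>\<^sup>2 = 1 / n" using n by (simp add: \<theta>_def power_divide)
    have \<theta>: "0 \<le> \<theta>" "\<theta> \<le> 1" "\<theta>\<^sup>2 / 2 * s \<le> 1"
      using n s unfolding \<theta>2 by (auto simp: \<theta>_def field_simps)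
    let ?q = "(1 - \<theta>\<^sup>2 / 2 * s) ^ n"
    have q: "?q = (1 + (- s / 2) / n) ^ n" "\<bar>?q\<bar> \<le> 1"
      using \<theta> s unfolding \<theta>2 by (simp_all add: power_abs abs_le_iff power_le_one mult.commute)
    have \<phi>: "\<phi> n = (\<integral>\<omega>. iexp (\<theta> * path_sum g n (traj \<omega>)) \<partial>M)"
      by (simp add: \<phi>_def \<theta>_def)
    have p0: "cmod (\<psi> \<theta> 0 - 1) \<le> B / n"
      using near[of \<theta> 0] by (simp add: path_sum_def prob_space \<theta>2)
    have "cmod (of_real ?q * (\<psi> \<theta> 0 - 1)) \<le> 1 * (B / n)"
      unfolding norm_mult norm_of_real using q(2) p0 by (intro mult_mono) auto
    moreover have "n * (2 * B ^ 3 * \<theta> ^ 3) = 2 * B ^ 3 / sqrt n"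
      using n by (simp add: \<theta>_def power_divide power3_eq_cube)
    moreover have "\<phi> n - of_real ?q = - (\<psi> \<theta> n - \<phi> n) + (\<psi> \<theta> n - of_real ?q * \<psi> \<theta> 0) + of_real ?q * (\<psi> \<theta> 0 - 1)"
      by (simp add: algebra_simps)
    ultimately have "cmod (\<phi> n - of_real ?q) \<le> \<theta>\<^sup>2 * B + 2 * B ^ 3 / sqrt n + 1 * (B / n)"
      using iterate[OF \<theta>, of n] near[of \<theta> n] unfolding \<phi>[symmetric]
      by (metis (no_types, lifting) add_mono norm_minus_cancel norm_triangle_mono)
    then show ?thesis unfolding q(1) \<theta>2 by (simp add: mult.commute add.commute)
  qed
  have "(\<lambda>n. \<phi> n - of_real ((1 + (- s / 2) / n) ^ n)) \<longlonglongrightarrow> 0"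
  proof (rule Lim_null_comparison)
    show "\<forall>\<^sub>F n in sequentially. cmod (\<phi> n - of_real ((1 + (- s / 2) / n) ^ n)) \<le> 2 * B ^ 3 / sqrt n + 2 * B / n"
      using eventually_ge_at_top[of "max 1 (nat \<lceil>s\<rceil>)"]
    proof eventually_elim
      case (elim n)
      then have "1 \<le> n" "s \<le> n" by linarith+
      then show ?case by (rule bound)
    qed
    show "(\<lambda>n. 2 * B ^ 3 / sqrt n + 2 * B / n) \<longlonglongrightarrow> 0"
      by (intro tendsto_add_zero tendsto_divide_0[OF tendsto_const] filterlim_at_top_imp_at_infinity
          filterlim_compose[OF sqrt_at_top] filterlim_real_sequentially)
  qed
  moreover have "(\<lambda>n. complex_of_real ((1 + (- s / 2) / n) ^ n)) \<longlonglongrightarrow> of_real (exp (- s / 2))"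
    by (intro tendsto_of_real tendsto_exp_limit_sequentially)
  ultimately have "(\<lambda>n. (\<phi> n - of_real ((1 + (- s / 2) / n) ^ n)) + of_real ((1 + (- s / 2) / n) ^ n)) \<longlonglongrightarrow> 0 + of_real (exp (- s / 2))"
    by (rule tendsto_add)
  then show ?thesis by (simp add: \<phi>_def s_def)
qed

end

section \<open>Fluctuations of the transition counts\<close>

lemma iexp_lipschitz: "cmod (iexp u - iexp v) \<le> \<bar>u - v\<bar>"
proof -
  have "iexp u - iexp v = iexp v * (iexp (u - v) - 1)"
    by (simp add: right_diff_distrib exp_add[symmetric])
  then have "cmod (iexp u - iexp v) = cmod (iexp (u - v) - 1)"
    by (simp add: norm_mult)
  also have "\<dots> \<le> \<bar>u - v\<bar>" using iexp_approx1[of "u - v" 0] by simp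
  finally show ?thesis .
qed

context ergodic_chain
begin

text \<open>The transition counts minus their compensators; entries are \<open>(N_ij - N_i p_ij) / sqrt n\<close>.\<close>

definition edge_fluctuation :: "nat \<Rightarrow> (nat \<Rightarrow> 's) \<Rightarrow> real^'s^'s" where
  "edge_fluctuation n x =
     (\<chi> i j. (\<Sum>t<n. of_bool (x t = i) * (of_bool (x (Suc t) = j) - P $ i $ j)) / sqrt n)"

definition occupation :: "nat \<Rightarrow> (nat \<Rightarrow> 's) \<Rightarrow> real^'s" where
  "occupation n x = (\<chi> i. (\<Sum>t<n. of_bool (x t = i)) / n)"

text \<open>A linear functional with coefficients \<open>c\<close> of the fluctuation matrix is a sum over transitions of
  this function, whose conditional mean is zero.\<close>

definition centering :: "real^'s^'s \<Rightarrow> 's \<Rightarrow> 's \<Rightarrow> real" where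
  "centering c i j = c $ i $ j - (\<Sum>l\<in>UNIV. P $ i $ l * c $ i $ l)"

lemma P_sum: "(\<Sum>j\<in>UNIV. P $ i $ j) = 1"
  using stochastic by (simp add: stochastic_matrix_def)

lemma \<pi>_pos: "0 < \<pi> $ i"
  by (rule stationary_pos[OF stochastic irreducible stationary])

lemma centered_centering: "centered (centering c)"
  by (simp add: centered_def centering_def right_diff_distrib sum_subtractf sum_distrib_right[symmetric] P_sum)

lemma edge_fluctuation_inner: "c \<bullet> edge_fluctuation n x = path_sum (centering c) n x / sqrt n"
proof -
  have step: "(\<Sum>i\<in>UNIV. \<Sum>j\<in>UNIV. c $ i $ j * (of_bool (k = i) * (of_bool (l = j) - P $ i $ j))) = centering c k l" for k l
  proof -
    have "(\<Sum>i\<in>UNIV. \<Sum>j\<in>UNIV. c $ i $ j * (of_bool (k = i) * (of_bool (l = j) - P $ i $ j))) =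
      (\<Sum>i\<in>UNIV. if k = i then \<Sum>j\<in>UNIV. c $ i $ j * (of_bool (l = j) - P $ i $ j) else 0)"
      by (intro sum.cong refl) simp
    also have "\<dots> = (\<Sum>j\<in>UNIV. c $ k $ j * (of_bool (l = j) - P $ k $ j))"
      by simp
    also have "\<dots> = (\<Sum>j\<in>UNIV. (if l = j then c $ k $ j else 0) - P $ k $ j * c $ k $ j)"
      by (intro sum.cong refl) (simp add: algebra_simps)
    also have "\<dots> = centering c k l"
      unfolding sum_subtractf by (simp add: centering_def)
    finally show ?thesis .
  qed
  have "c \<bullet> edge_fluctuation n x =
    (\<Sum>i\<in>UNIV. \<Sum>j\<in>UNIV. \<Sum>t<n. c $ i $ j * (of_bool (x t = i) * (of_bool (x (Suc t) = j) - P $ i $ j))) / sqrt n"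
    by (simp only: inner_matrix edge_fluctuation_def vec_lambda_beta sum_distrib_left sum_divide_distrib times_divide_eq_right)
  also have "(\<Sum>i\<in>UNIV. \<Sum>j\<in>UNIV. \<Sum>t<n. c $ i $ j * (of_bool (x t = i) * (of_bool (x (Suc t) = j) - P $ i $ j))) =
    (\<Sum>i\<in>UNIV. \<Sum>t<n. \<Sum>j\<in>UNIV. c $ i $ j * (of_bool (x t = i) * (of_bool (x (Suc t) = j) - P $ i $ j)))"
    by (intro sum.cong refl sum.swap)
  also have "\<dots> = (\<Sum>t<n. \<Sum>i\<in>UNIV. \<Sum>j\<in>UNIV. c $ i $ j * (of_bool (x t = i) * (of_bool (x (Suc t) = j) - P $ i $ j)))"
    by (rule sum.swap)
  also have "\<dots> = path_sum (centering c) n x"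
    unfolding step by (simp add: path_sum_def)
  finally show ?thesis .
qed

lemma asymptotic_variance_centering:
  "asymptotic_variance (centering c) =
    (\<Sum>i\<in>UNIV. \<pi> $ i * ((\<Sum>j\<in>UNIV. P $ i $ j * (c $ i $ j)\<^sup>2) - (\<Sum>j\<in>UNIV. P $ i $ j * c $ i $ j)\<^sup>2))"
proof -
  have "(\<Sum>j\<in>UNIV. P $ i $ j * (centering c i j)\<^sup>2) =
      (\<Sum>j\<in>UNIV. P $ i $ j * (c $ i $ j)\<^sup>2) - (\<Sum>j\<in>UNIV. P $ i $ j * c $ i $ j)\<^sup>2" for i
  proof -
    define b where "b = (\<Sum>j\<in>UNIV. P $ i $ j * c $ i $ j)"
    have "(\<Sum>j\<in>UNIV. P $ i $ j * (centering c i j)\<^sup>2) =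
       (\<Sum>j\<in>UNIV. P $ i $ j * (c $ i $ j)\<^sup>2 - (P $ i $ j * c $ i $ j) * (2 * b) + P $ i $ j * b\<^sup>2)"
      unfolding centering_def b_def[symmetric]
      by (intro sum.cong refl) (simp add: power2_eq_square algebra_simps)
    also have "\<dots> = (\<Sum>j\<in>UNIV. P $ i $ j * (c $ i $ j)\<^sup>2) - b * (2 * b) + 1 * b\<^sup>2"
      unfolding sum.distrib sum_subtractf sum_distrib_right[symmetric] P_sum b_def[symmetric] by (rule refl)
    finally show ?thesis unfolding b_def[symmetric] by (simp add: power2_eq_square)
  qed
  then show ?thesis by (simp add: asymptotic_variance_def)
qed

lemma determined_by_edge_fluctuation: "determined_by n (edge_fluctuation n)"
  by (rule determined_byI) (auto simp: edge_fluctuation_def vec_eq_iff intro!: arg_cong2[where f = "(/)"] sum.cong)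

lemma determined_by_occupation: "determined_by n (occupation n)"
  by (rule determined_byI) (auto simp: occupation_def vec_eq_iff intro!: arg_cong2[where f = "(/)"] sum.cong)

text \<open>For a solution \<open>h\<close> of the Poisson equation of the indicator of \<open>i\<close>, the sum of
  \<open>1{X_t = i} - \<pi>_i\<close> is a martingale plus the boundary term \<open>h(X_0) - h(X_n)\<close>, hence of order
  \<open>sqrt n\<close> in mean.\<close>

lemma occupation_error:
  "\<exists>C. \<forall>n\<ge>1. (\<integral>\<omega>. \<bar>occupation n (traj \<omega>) $ i - \<pi> $ i\<bar> \<partial>M) \<le> C / sqrt n"
proof -
  obtain h where h: "\<And>k. h k - (\<Sum>j\<in>UNIV. P $ k $ j * h j) = of_bool (k = i) - \<pi> $ i"
  proof -
    have "(\<Sum>j\<in>UNIV. \<pi> $ j * of_bool (j = i)) = \<pi> $ i"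
      by (simp add: of_bool_def if_distrib cong: if_cong)
    then show ?thesis using poisson_function[of "\<lambda>k. of_bool (k = i)"] that by auto
  qed
  define g where "g = (\<lambda>k j. h j - (\<Sum>l\<in>UNIV. P $ k $ l * h l))"
  have g: "centered g"
    by (simp add: centered_def g_def right_diff_distrib sum_subtractf sum_distrib_right[symmetric] P_sum)
  obtain B1 where B1: "\<And>z. \<bar>case_prod g z\<bar> \<le> B1"
    using finite_function_bound[of "case_prod g"] by blast
  have gB: "\<bar>g k j\<bar> \<le> B1" for k j
    using B1[of "(k, j)"] by simp
  obtain B2 where B2: "1 \<le> B2" "\<And>k. \<bar>h k\<bar> \<le> B2"
    using finite_function_bound[of h] by blast
  have tele: "(\<Sum>t<n. of_bool (x t = i) - \<pi> $ i) = path_sum g n x + (h (x 0) - h (x n))" for n x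
    by (induction n) (auto simp: path_sum_def g_def h[symmetric])
  have pt: "\<bar>occupation n x $ i - \<pi> $ i\<bar> \<le> (\<bar>path_sum g n x\<bar> + 2 * B2) / n" if n: "1 \<le> n" for n x
  proof -
    have "occupation n x $ i - \<pi> $ i = (\<Sum>t<n. of_bool (x t = i) - \<pi> $ i) / n"
      using n by (simp add: occupation_def sum_subtractf field_simps)
    moreover have "\<bar>path_sum g n x + (h (x 0) - h (x n))\<bar> \<le> \<bar>path_sum g n x\<bar> + 2 * B2"
      using B2(2)[of "x 0"] B2(2)[of "x n"] by linarith
    ultimately show ?thesis
      using n unfolding tele by (simp add: divide_right_mono)
  qed
  have "(\<integral>\<omega>. \<bar>occupation n (traj \<omega>) $ i - \<pi> $ i\<bar> \<partial>M) \<le> (1 + B1\<^sup>2 + 2 * B2) / sqrt n" if n: "1 \<le> n" for n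
  proof -
    have i1: "integrable M (\<lambda>\<omega>. \<bar>path_sum g n (traj \<omega>)\<bar>)"
      by (rule integrable_determined[OF determined_by_comp[OF determined_by_path_sum[of n g], of abs]])
    have i2: "integrable M (\<lambda>\<omega>. \<bar>occupation n (traj \<omega>) $ i - \<pi> $ i\<bar>)"
      by (rule integrable_determined[OF determined_by_comp[OF determined_by_occupation[of n], of "\<lambda>v. \<bar>v $ i - \<pi> $ i\<bar>"]])
    have "(\<integral>\<omega>. \<bar>occupation n (traj \<omega>) $ i - \<pi> $ i\<bar> \<partial>M) \<le> (\<integral>\<omega>. (\<bar>path_sum g n (traj \<omega>)\<bar> + 2 * B2) / n \<partial>M)"
      using i1 i2 pt[OF n] by (intro integral_mono) auto
    also have "\<dots> = ((\<integral>\<omega>. \<bar>path_sum g n (traj \<omega>)\<bar> \<partial>M) + 2 * B2) / n"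
      using i1 by (simp add: prob_space)
    also have "\<dots> \<le> (sqrt n * (1 + B1\<^sup>2) + sqrt n * (2 * B2)) / n"
    proof (intro divide_right_mono add_mono first_moment_path_sum g gB)
      have "1 \<le> sqrt n" using n by simp
      then show "2 * B2 \<le> sqrt n * (2 * B2)" using B2 by (simp add: mult_le_cancel_right1)
    qed simp
    also have "\<dots> = (1 + B1\<^sup>2 + 2 * B2) * (sqrt n / n)"
      by (simp add: field_simps)
    also have "sqrt n / n = 1 / sqrt n"
      using n by (simp add: real_div_sqrt field_simps)
    finally show ?thesis by simp
  qed
  then show ?thesis by blast
qed

lemma occupation_tendsto:
  "(\<lambda>n. \<integral>\<omega>. \<bar>occupation n (traj \<omega>) $ i - \<pi> $ i\<bar> \<partial>M) \<longlonglongrightarrow> 0"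
proof -
  obtain C where C: "\<And>n. n \<ge> 1 \<Longrightarrow> (\<integral>\<omega>. \<bar>occupation n (traj \<omega>) $ i - \<pi> $ i\<bar> \<partial>M) \<le> C / sqrt n"
    using occupation_error[of i] by blast
  show ?thesis
  proof (rule tendsto_sandwich[of "\<lambda>_. 0"])
    show "\<forall>\<^sub>F n in sequentially. (\<integral>\<omega>. \<bar>occupation n (traj \<omega>) $ i - \<pi> $ i\<bar> \<partial>M) \<le> C / sqrt n"
      using eventually_ge_at_top[of 1] by eventually_elim (rule C)
    show "(\<lambda>n. C / sqrt n) \<longlonglongrightarrow> 0"
      by (intro tendsto_divide_0[OF tendsto_const] filterlim_at_top_imp_at_infinity
          filterlim_compose[OF sqrt_at_top] filterlim_real_sequentially)
  qed auto
qed

text \<open>The deterministic last component turns \<open>Q = P + (1 / sqrt n) sqrt n (Q - P)\<close> into a continuous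
  function of the state that does not depend on \<open>n\<close>.\<close>

definition empirical_state :: "nat \<Rightarrow> (nat \<Rightarrow> 's) \<Rightarrow> (real^'s^'s) \<times> (real^'s) \<times> real" where
  "empirical_state n x = (edge_fluctuation n x, occupation n x, 1 / sqrt n)"

lemma determined_by_empirical_state: "determined_by n (empirical_state n)"
  unfolding empirical_state_def
  by (rule determined_by_comp2[OF determined_by_edge_fluctuation determined_by_occupation, of n "\<lambda>v l. (v, l, 1 / sqrt n)"])

text \<open>The last two components have constant limits, so replacing them by these limits costs at most
  their mean distance from them (Slutsky), and the central limit theorem applies to the first.\<close>

lemma empirical_state_char:
  "(\<lambda>n. \<integral>\<omega>. iexp ((c, d, e) \<bullet> empirical_state n (traj \<omega>)) \<partial>M) \<longlonglongrightarrow>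
     iexp (d \<bullet> \<pi>) * exp (- asymptotic_variance (centering c) / 2)"
proof -
  let ?V = "\<lambda>n \<omega>. c \<bullet> edge_fluctuation n (traj \<omega>)"
  let ?L = "\<lambda>n \<omega>. occupation n (traj \<omega>)"
  have intL: "integrable M (\<lambda>\<omega>. \<bar>?L n \<omega> $ i - \<pi> $ i\<bar>)" for n i
    by (rule integrable_determined[OF determined_by_comp[OF determined_by_occupation[of n], of "\<lambda>v. \<bar>v $ i - \<pi> $ i\<bar>"]])
  have int1: "integrable M (\<lambda>\<omega>. iexp ((c, d, e) \<bullet> empirical_state n (traj \<omega>)))" for n
    by (rule integrable_determined[OF determined_by_comp[OF determined_by_empirical_state[of n], of "\<lambda>v. iexp ((c, d, e) \<bullet> v)"]])
  have int2: "integrable M (\<lambda>\<omega>. iexp (?V n \<omega> + d \<bullet> \<pi>))" for n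
    by (rule integrable_determined[OF determined_by_comp[OF determined_by_edge_fluctuation[of n], of "\<lambda>v. iexp (c \<bullet> v + d \<bullet> \<pi>)"]])
  have "(\<lambda>n. (\<integral>\<omega>. iexp ((c, d, e) \<bullet> empirical_state n (traj \<omega>)) \<partial>M) - (\<integral>\<omega>. iexp (?V n \<omega> + d \<bullet> \<pi>) \<partial>M)) \<longlonglongrightarrow> 0"
  proof (rule Lim_null_comparison[OF always_eventually], intro allI)
    fix n
    have pt: "cmod (iexp ((c, d, e) \<bullet> empirical_state n (traj \<omega>)) - iexp (?V n \<omega> + d \<bullet> \<pi>)) \<le>
        (\<Sum>i\<in>UNIV. \<bar>d $ i\<bar> * \<bar>?L n \<omega> $ i - \<pi> $ i\<bar>) + \<bar>e\<bar> / sqrt n" for \<omega>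
    proof -
      have "cmod (iexp ((c, d, e) \<bullet> empirical_state n (traj \<omega>)) - iexp (?V n \<omega> + d \<bullet> \<pi>)) \<le>
         \<bar>(c, d, e) \<bullet> empirical_state n (traj \<omega>) - (?V n \<omega> + d \<bullet> \<pi>)\<bar>"
        by (rule iexp_lipschitz)
      also have "(c, d, e) \<bullet> empirical_state n (traj \<omega>) - (?V n \<omega> + d \<bullet> \<pi>) =
         (\<Sum>i\<in>UNIV. d $ i * (?L n \<omega> $ i - \<pi> $ i)) + e / sqrt n"
        by (simp add: empirical_state_def inner_vec_def[of d] right_diff_distrib sum_subtractf)
      also have "\<bar>\<dots>\<bar> \<le> (\<Sum>i\<in>UNIV. \<bar>d $ i * (?L n \<omega> $ i - \<pi> $ i)\<bar>) + \<bar>e / sqrt n\<bar>"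
        by (intro order_trans[OF abs_triangle_ineq] add_mono sum_abs order_refl)
      finally show ?thesis by (simp add: abs_mult)
    qed
    have bound_int: "integrable M (\<lambda>\<omega>. (\<Sum>i\<in>UNIV. \<bar>d $ i\<bar> * \<bar>?L n \<omega> $ i - \<pi> $ i\<bar>) + \<bar>e\<bar> / sqrt n)"
      by (intro Bochner_Integration.integrable_add Bochner_Integration.integrable_sum integrable_mult_right intL) simp
    have "(\<integral>\<omega>. iexp ((c, d, e) \<bullet> empirical_state n (traj \<omega>)) \<partial>M) - (\<integral>\<omega>. iexp (?V n \<omega> + d \<bullet> \<pi>) \<partial>M) =
        (\<integral>\<omega>. iexp ((c, d, e) \<bullet> empirical_state n (traj \<omega>)) - iexp (?V n \<omega> + d \<bullet> \<pi>) \<partial>M)"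
      by (rule Bochner_Integration.integral_diff[OF int1 int2, symmetric])
    also have "cmod \<dots> \<le> (\<integral>\<omega>. cmod (iexp ((c, d, e) \<bullet> empirical_state n (traj \<omega>)) - iexp (?V n \<omega> + d \<bullet> \<pi>)) \<partial>M)"
      by (rule integral_norm_bound)
    also have "\<dots> \<le> (\<integral>\<omega>. (\<Sum>i\<in>UNIV. \<bar>d $ i\<bar> * \<bar>?L n \<omega> $ i - \<pi> $ i\<bar>) + \<bar>e\<bar> / sqrt n \<partial>M)"
      by (rule integral_mono[OF integrable_norm[OF Bochner_Integration.integrable_diff[OF int1 int2]] bound_int pt])
    also have "\<dots> = (\<Sum>i\<in>UNIV. \<bar>d $ i\<bar> * (\<integral>\<omega>. \<bar>?L n \<omega> $ i - \<pi> $ i\<bar> \<partial>M)) + \<bar>e\<bar> / sqrt n"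
      by (simp add: intL prob_space Bochner_Integration.integral_sum)
    finally show "cmod ((\<integral>\<omega>. iexp ((c, d, e) \<bullet> empirical_state n (traj \<omega>)) \<partial>M) - (\<integral>\<omega>. iexp (?V n \<omega> + d \<bullet> \<pi>) \<partial>M))
       \<le> (\<Sum>i\<in>UNIV. \<bar>d $ i\<bar> * (\<integral>\<omega>. \<bar>?L n \<omega> $ i - \<pi> $ i\<bar> \<partial>M)) + \<bar>e\<bar> / sqrt n" .
  next
    show "(\<lambda>n. (\<Sum>i\<in>UNIV. \<bar>d $ i\<bar> * (\<integral>\<omega>. \<bar>?L n \<omega> $ i - \<pi> $ i\<bar> \<partial>M)) + \<bar>e\<bar> / sqrt n) \<longlonglongrightarrow> 0"
      by (intro tendsto_add_zero tendsto_null_sum tendsto_mult_right_zero occupation_tendsto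
          tendsto_divide_0[OF tendsto_const] filterlim_at_top_imp_at_infinity
          filterlim_compose[OF sqrt_at_top] filterlim_real_sequentially)
  qed
  moreover have "(\<lambda>n. \<integral>\<omega>. iexp (?V n \<omega> + d \<bullet> \<pi>) \<partial>M) \<longlonglongrightarrow>
      iexp (d \<bullet> \<pi>) * exp (- asymptotic_variance (centering c) / 2)"
  proof -
    have "(\<integral>\<omega>. iexp (?V n \<omega> + d \<bullet> \<pi>) \<partial>M) =
        iexp (d \<bullet> \<pi>) * (\<integral>\<omega>. iexp (path_sum (centering c) n (traj \<omega>) / sqrt n) \<partial>M)" for n
      by (simp add: edge_fluctuation_inner exp_add distrib_left mult.commute)
    then show ?thesis
      using tendsto_mult_left[OF clt_path_sum[OF centered_centering[of c]], of "iexp (d \<bullet> \<pi>)"] by simp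
  qed
  ultimately have "(\<lambda>n. ((\<integral>\<omega>. iexp ((c, d, e) \<bullet> empirical_state n (traj \<omega>)) \<partial>M) - (\<integral>\<omega>. iexp (?V n \<omega> + d \<bullet> \<pi>) \<partial>M))
      + (\<integral>\<omega>. iexp (?V n \<omega> + d \<bullet> \<pi>) \<partial>M)) \<longlonglongrightarrow> 0 + iexp (d \<bullet> \<pi>) * exp (- asymptotic_variance (centering c) / 2)"
    by (rule tendsto_add)
  then show ?thesis by simp
qed

end

section \<open>The limiting availability errors\<close>

text \<open>The derivative at \<open>P\<close> of the availability at time \<open>k\<close> with respect to the transition matrix.\<close>

definition avail_gradient :: "real^'s^'s \<Rightarrow> real^'s \<Rightarrow> 's set \<Rightarrow> nat \<Rightarrow> real^'s^'s" where
  "avail_gradient P a U k =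
     (\<chi> p q. \<Sum>i<k. (a v* matpow P i) $ p * (matpow P (k - 1 - i) *v indicator_vec U) $ q)"

lemma vector_matrix_sum_right: "(a :: real^'n) v* (\<Sum>i\<in>I. A i) = (\<Sum>i\<in>I. a v* (A i :: real^'m^'n))"
  by (induction I rule: infinite_finite_induct)
    (simp_all add: vec_eq_iff vector_matrix_mult_def distrib_left distrib_right sum.distrib)

lemma Z_avail_eq_inner: "Z_avail P a U W k = avail_gradient P a U k \<bullet> W"
proof -
  have "Z_avail P a U W k = (\<Sum>i<k. (a v* matpow P i) \<bullet> (W *v (matpow P (k - 1 - i) *v indicator_vec U)))"
    by (simp add: Z_avail_def W_pow_def vector_matrix_sum_right inner_sum_left vector_matrix_mul_assoc[symmetric] dot_lmul_matrix)
  also have "\<dots> = (\<Sum>i<k. \<Sum>p\<in>UNIV. \<Sum>q\<in>UNIV.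
      (a v* matpow P i) $ p * (matpow P (k - 1 - i) *v indicator_vec U) $ q * W $ p $ q)"
    by (simp add: inner_vec_def matrix_vector_mult_def[of W] sum_distrib_left mult_ac)
  also have "\<dots> = (\<Sum>p\<in>UNIV. \<Sum>i<k. \<Sum>q\<in>UNIV.
      (a v* matpow P i) $ p * (matpow P (k - 1 - i) *v indicator_vec U) $ q * W $ p $ q)"
    by (rule sum.swap)
  also have "\<dots> = (\<Sum>p\<in>UNIV. \<Sum>q\<in>UNIV. \<Sum>i<k.
      (a v* matpow P i) $ p * (matpow P (k - 1 - i) *v indicator_vec U) $ q * W $ p $ q)"
    by (intro sum.cong refl sum.swap)
  finally show ?thesis
    by (simp add: inner_matrix avail_gradient_def sum_distrib_right)
qed

lemma sum_UNIV_prod: "(\<Sum>c\<in>UNIV. f c) = (\<Sum>i\<in>UNIV. \<Sum>j\<in>UNIV. f (i, j))" for f :: "'a::finite \<times> 'b::finite \<Rightarrow> 'c::comm_monoid_add"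
  by (simp add: sum.cartesian_product)

text \<open>The row vector \<open>(a \<otimes> e_U^T) M_k\<close> is the gradient, flattened row by row like \<open>vec (W^T)\<close>.\<close>

lemma avail_gradient_eq_kronecker:
  "(\<Sum>c\<in>UNIV. a $ fst c * indicator_vec U $ snd c * M_mat P k $ c $ d) = avail_gradient P a U k $ fst d $ snd d"
proof -
  have "(\<Sum>c\<in>UNIV. a $ fst c * indicator_vec U $ snd c * M_mat P k $ c $ d) =
     (\<Sum>i<k. \<Sum>c\<in>UNIV. a $ fst c * indicator_vec U $ snd c * (matpow P i $ fst c $ fst d * matpow P (k - 1 - i) $ snd d $ snd c))"
    by (subst sum.swap) (simp add: M_mat_def kronecker_def transpose_def sum_distrib_left)
  also have "\<dots> = (\<Sum>i<k. \<Sum>p\<in>UNIV. \<Sum>q\<in>UNIV. a $ p * indicator_vec U $ q * (matpow P i $ p $ fst d * matpow P (k - 1 - i) $ snd d $ q))"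
    by (simp add: sum_UNIV_prod)
  also have "\<dots> = (\<Sum>i<k. (a v* matpow P i) $ fst d * (matpow P (k - 1 - i) *v indicator_vec U) $ snd d)"
    by (simp add: vector_matrix_mult_def matrix_vector_mult_def sum_product mult_ac)
  finally show ?thesis by (simp add: avail_gradient_def)
qed

lemma covariance_Z_avail:
  fixes W :: "'v \<Rightarrow> real^'s^'s"
  assumes W: "centered_gaussian N W"
  shows "covariance N (\<lambda>\<omega>. Z_avail P a U (W \<omega>) k) (\<lambda>\<omega>. Z_avail P a U (W \<omega>) l) =
      (((rowvector a :: real^'s^1) \<otimes>\<^sub>K (rowvector (indicator_vec U) :: real^'s^1))
        ** M_mat P k ** Sigma_p N W ** transpose (M_mat P l)
        ** ((columnvector a :: real^1^'s) \<otimes>\<^sub>K (columnvector (indicator_vec U) :: real^1^'s)))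
      $ (1, 1) $ (1, 1)"
proof -
  let ?R = "(rowvector a :: real^'s^1) \<otimes>\<^sub>K (rowvector (indicator_vec U) :: real^'s^1)"
  let ?C = "(columnvector a :: real^1^'s) \<otimes>\<^sub>K (columnvector (indicator_vec U) :: real^1^'s)"
  let ?G = "\<lambda>k d. avail_gradient P a U k $ fst d $ snd d"
  have R: "(?R ** M_mat P k) $ (1, 1) $ d = ?G k d" for d
    using avail_gradient_eq_kronecker[of a U P k d]
    by (simp add: matrix_matrix_mult_def kronecker_def rowvector_def)
  have C: "(transpose (M_mat P l) ** ?C) $ d $ (1, 1) = ?G l d" for d
    using avail_gradient_eq_kronecker[of a U P l d]
    by (simp add: matrix_matrix_mult_def kronecker_def columnvector_def transpose_def mult_ac)
  have \<Sigma>: "Sigma_p N W $ c $ d = covariance N (\<lambda>\<omega>. W \<omega> $ fst c $ snd c) (\<lambda>\<omega>. W \<omega> $ fst d $ snd d)" for c d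
    by (simp add: Sigma_p_def covariance_matrix_def vec_cols_def transpose_def)
  have "(?R ** M_mat P k ** Sigma_p N W ** transpose (M_mat P l) ** ?C) $ (1, 1) $ (1, 1) =
      ((?R ** M_mat P k) ** (Sigma_p N W ** (transpose (M_mat P l) ** ?C))) $ (1, 1) $ (1, 1)"
    by (simp add: matrix_mul_assoc)
  also have "\<dots> = (\<Sum>c\<in>UNIV. \<Sum>d\<in>UNIV. ?G k c * ?G l d * Sigma_p N W $ c $ d)"
    unfolding matrix_matrix_mult_def[of "?R ** M_mat P k"] matrix_matrix_mult_def[of "Sigma_p N W"]
    by (simp add: R C sum_distrib_left mult_ac)
  also have "\<dots> = (\<Sum>i\<in>UNIV. \<Sum>j\<in>UNIV. \<Sum>p\<in>UNIV. \<Sum>q\<in>UNIV. ?G k (i, j) * ?G l (p, q) * Sigma_p N W $ (i, j) $ (p, q))"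
    by (simp add: sum_UNIV_prod)
  finally show ?thesis
    by (simp add: Z_avail_eq_inner gaussian_covariance[OF W] \<Sigma>)
qed

section \<open>The availability errors as a function of the fluctuations\<close>

lemma continuous_on_matrix_mult:
  fixes A :: "'a::topological_space \<Rightarrow> real^'n^'m" and B :: "'a \<Rightarrow> real^'p^'n"
  assumes "continuous_on S A" "continuous_on S B"
  shows "continuous_on S (\<lambda>z. A z ** B z)"
  unfolding matrix_matrix_mult_def by (intro continuous_intros assms)

lemma continuous_on_matpow:
  fixes A :: "'a::topological_space \<Rightarrow> real^'n^'n"
  assumes "continuous_on S A"
  shows "continuous_on S (\<lambda>z. matpow (A z) k)"
  by (induction k) (simp_all add: continuous_on_matrix_mult assms)

lemma continuous_on_vector_matrix_mult:
  fixes A :: "'a::topological_space \<Rightarrow> real^'n^'m"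
  assumes "continuous_on S A"
  shows "continuous_on S (\<lambda>z. a v* A z)"
  unfolding vector_matrix_mult_def by (intro continuous_intros assms)

lemma matrix_mul_scaleR_left: "(c *\<^sub>R A) ** B = c *\<^sub>R (A ** B)" for A :: "real^'n^'m" and B :: "real^'p^'n"
  by (simp add: matrix_matrix_mult_def vec_eq_iff sum_distrib_left mult.assoc)

lemma matrix_mul_scaleR_right: "A ** (c *\<^sub>R B) = c *\<^sub>R (A ** B)" for A :: "real^'n^'m" and B :: "real^'p^'n"
  by (simp add: matrix_matrix_mult_def vec_eq_iff sum_distrib_left mult.left_commute)

lemma vector_matrix_mul_scaleR: "a v* (c *\<^sub>R A) = c *\<^sub>R (a v* A)" for A :: "real^'n^'m"
  by (simp add: vector_matrix_mult_def vec_eq_iff sum_distrib_left mult_ac)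

lemma matrix_mul_sum_right: "A ** (\<Sum>i\<in>I. B i) = (\<Sum>i\<in>I. A ** B i)" for A :: "real^'n^'m" and B :: "'i \<Rightarrow> real^'p^'n"
  by (induction I rule: infinite_finite_induct) (simp_all add: matrix_add_ldistrib)

lemma matrix_add_right_distrib: "(A + B) ** C = A ** C + B ** C" for A B :: "real^'n^'m" and C :: "real^'p^'n"
  by (simp add: matrix_matrix_mult_def vec_eq_iff distrib_right sum.distrib)

lemma matpow_diff_telescope:
  "matpow (P + E) k = matpow P k + (\<Sum>i<k. matpow P i ** E ** matpow (P + E) (k - 1 - i))"
proof (induction k)
  case (Suc k)
  have "matpow (P + E) (Suc k) = E ** matpow (P + E) k + P ** matpow (P + E) k"
    by (simp add: matrix_add_right_distrib add.commute)
  also have "P ** matpow (P + E) k = P ** matpow P k + (\<Sum>i<k. P ** (matpow P i ** E ** matpow (P + E) (k - 1 - i)))"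
    by (subst Suc.IH) (simp add: matrix_add_ldistrib matrix_mul_sum_right)
  finally show ?case
    unfolding sum.lessThan_Suc_shift by (simp add: matrix_mul_assoc add_ac del: sum.lessThan_Suc)
qed simp

lemma transition_count_eq_sum:
  "real (transition_count x n i j) = (\<Sum>t<n. of_bool (x t = i) * of_bool (x (Suc t) = j))"
proof -
  have "(\<Sum>t<n. of_bool (x t = i) * of_bool (x (Suc t) = j)) = (\<Sum>t<n. of_bool (x t = i \<and> x (Suc t) = j) :: real)"
    by (intro sum.cong refl) auto
  also have "\<dots> = real (card ({..<n} \<inter> {t. x t = i \<and> x (Suc t) = j}))"
    by (simp add: sum_of_bool_eq)
  also have "{..<n} \<inter> {t. x t = i \<and> x (Suc t) = j} = {t. t < n \<and> x t = i \<and> x (Suc t) = j}"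
    by auto
  finally show ?thesis by (simp add: transition_count_def)
qed

lemma visit_count_eq_sum: "real (visit_count x n i) = (\<Sum>t<n. of_bool (x t = i))"
proof -
  have "real (visit_count x n i) = (\<Sum>j\<in>UNIV. \<Sum>t<n. of_bool (x t = i) * of_bool (x (Suc t) = j))"
    by (simp add: visit_count_def transition_count_eq_sum)
  also have "\<dots> = (\<Sum>t<n. \<Sum>j\<in>UNIV. of_bool (x t = i) * of_bool (x (Suc t) = j))"
    by (rule sum.swap)
  also have "\<dots> = (\<Sum>t<n. of_bool (x t = i))"
    by (intro sum.cong refl) (simp add: sum_distrib_left[symmetric] of_bool_def)
  finally show ?thesis .
qed

lemma determined_by_transition_count: "determined_by n (\<lambda>x. transition_count x n)"
proof (rule determined_byI, intro ext)
  fix x y :: "nat \<Rightarrow> 's" and i j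
  assume "\<And>u. u \<le> n \<Longrightarrow> x u = y u"
  then have "{t. t < n \<and> x t = i \<and> x (Suc t) = j} = {t. t < n \<and> y t = i \<and> y (Suc t) = j}"
    by auto
  then show "transition_count x n i j = transition_count y n i j"
    by (simp add: transition_count_def)
qed

lemma determined_by_empirical_matrix: "determined_by n (\<lambda>x :: nat \<Rightarrow> 's::finite. empirical_matrix x n)"
  unfolding empirical_matrix_def visit_count_def
  by (rule determined_by_comp[OF determined_by_transition_count,
      of n "\<lambda>c. \<chi> i j. if (\<Sum>j\<in>UNIV. c i j) = 0 then 0 else real (c i j) / real (\<Sum>j\<in>UNIV. c i j)"])

context ergodic_chain
begin

definition limit_state :: "real^'s^'s \<Rightarrow> (real^'s^'s) \<times> (real^'s) \<times> real" where
  "limit_state w = ((\<chi> i j. \<pi> $ i * w $ i $ j), \<pi>, 0)"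

text \<open>Truncating the denominators at \<open>\<pi>_i / 2\<close> makes the division continuous on the whole space
  and changes neither the limit, where the denominator is \<open>\<pi>_i\<close>, nor the value at an empirical
  state close to it.\<close>

definition row_errors :: "(real^'s^'s) \<times> (real^'s) \<times> real \<Rightarrow> real^'s^'s" where
  "row_errors z = (\<chi> i j. fst z $ i $ j / max (fst (snd z) $ i) (\<pi> $ i / 2))"

text \<open>At an empirical state close to its limit, the telescoped form of \<open>sqrt n (a Q^k e_U - a P^k e_U)\<close>
  with \<open>sqrt n (Q - P)\<close> given by the row errors; at the limit state, \<open>a W_(P^k) e_U\<close>.\<close>

definition avail_error :: "'s set \<Rightarrow> (real^'s^'s) \<times> (real^'s) \<times> real \<Rightarrow> nat \<Rightarrow> real" where
  "avail_error U z k =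
     (\<Sum>i<k. (a v* (matpow P i ** row_errors z ** matpow (P + snd (snd z) *\<^sub>R row_errors z) (k - 1 - i))) \<bullet> indicator_vec U)"

definition scaled_error :: "'s set \<Rightarrow> nat \<Rightarrow> (nat \<Rightarrow> 's) \<Rightarrow> nat \<Rightarrow> real" where
  "scaled_error U n x k = sqrt n * (availability_est a U k n x - availability M X U k)"

lemma continuous_row_errors: "continuous_on UNIV row_errors"
proof -
  have "max (fst (snd z) $ i) (\<pi> $ i / 2) \<noteq> 0" for z :: "(real^'s^'s) \<times> (real^'s) \<times> real" and i
    using \<pi>_pos[of i] by (simp add: max_def)
  then show ?thesis
    unfolding row_errors_def by (intro continuous_intros) auto
qed

lemma continuous_avail_error: "continuous_on UNIV (\<lambda>z. avail_error U z k)"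
  unfolding avail_error_def
  by (intro continuous_on_sum continuous_on_inner continuous_on_const continuous_on_vector_matrix_mult
      continuous_on_matrix_mult continuous_on_matpow continuous_on_add continuous_on_scaleR
      continuous_on_snd continuous_on_id continuous_row_errors)

lemma avail_error_limit_state: "avail_error U (limit_state w) k = Z_avail P a U w k"
proof -
  have "row_errors (limit_state w) = w"
  proof -
    have "max (\<pi> $ i) (\<pi> $ i / 2) = \<pi> $ i" for i using \<pi>_pos[of i] by simp
    moreover have "\<pi> $ i \<noteq> 0" for i using \<pi>_pos[of i] by simp
    ultimately show ?thesis by (simp add: row_errors_def limit_state_def vec_eq_iff)
  qed
  then show ?thesis
    by (simp add: avail_error_def limit_state_def Z_avail_def W_pow_def vector_matrix_sum_right inner_sum_left)
qed

lemma scaled_error_eq_avail_error: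
  assumes n: "1 \<le> n" and visits: "\<And>i. \<pi> $ i / 2 \<le> occupation n x $ i"
  shows "scaled_error U n x k = avail_error U (empirical_state n x) k"
proof -
  let ?D = "row_errors (empirical_state n x)" and ?r = "1 / sqrt n"
  have emp: "empirical_matrix x n = P + ?r *\<^sub>R ?D"
  proof -
    have "empirical_matrix x n $ i $ j = (P + ?r *\<^sub>R ?D) $ i $ j" for i j
    proof -
      define v where "v = real (visit_count x n i)"
      define c where "c = real (transition_count x n i j)"
      have L: "occupation n x $ i = v / n"
        by (simp add: occupation_def v_def visit_count_eq_sum)
      have V: "edge_fluctuation n x $ i $ j = (c - v * P $ i $ j) / sqrt n"
        by (simp add: edge_fluctuation_def c_def v_def transition_count_eq_sum visit_count_eq_sum
            right_diff_distrib sum_subtractf sum_distrib_right)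
      have L_pos: "0 < occupation n x $ i"
        using visits[of i] \<pi>_pos[of i] by linarith
      then have v: "v \<noteq> 0"
        using L by auto
      have D: "?D $ i $ j = ((c - v * P $ i $ j) / sqrt n) / (v / n)"
        using visits[of i] by (simp add: row_errors_def empirical_state_def V L[symmetric] max_absorb1)
      define s where "s = sqrt n"
      have s: "0 < s" "real n = s * s" using n by (simp_all add: s_def)
      have "?r * ?D $ i $ j = c / v - P $ i $ j"
        unfolding D s_def[symmetric] using s v by (simp add: field_simps)
      then show ?thesis
        using v by (simp add: empirical_matrix_def v_def c_def)
    qed
    then show ?thesis by (simp add: vec_eq_iff)
  qed
  have "scaled_error U n x k = sqrt n * ((a v* (\<Sum>i<k. matpow P i ** (?r *\<^sub>R ?D) ** matpow (P + ?r *\<^sub>R ?D) (k - 1 - i))) \<bullet> indicator_vec U)"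
    unfolding scaled_error_def availability_est_def availability_eq emp matpow_diff_telescope[of P _ k]
    by (simp add: vector_matrix_mult_def inner_add_left distrib_left distrib_right sum.distrib inner_vec_def)
  also have "\<dots> = sqrt n * (?r * avail_error U (empirical_state n x) k)"
    by (simp only: avail_error_def empirical_state_def snd_conv vector_matrix_sum_right inner_sum_left sum_distrib_left
        matrix_mul_scaleR_left matrix_mul_scaleR_right vector_matrix_mul_scaleR inner_scaleR_left mult.assoc)
  finally show ?thesis using n by simp
qed

lemma determined_by_scaled_error: "determined_by n (\<lambda>x. scaled_error U n x)"
  unfolding scaled_error_def availability_est_def
  by (rule determined_by_comp[OF determined_by_empirical_matrix,
      of n "\<lambda>Q k. sqrt n * ((a v* matpow Q k) \<bullet> indicator_vec U - availability M X U k)"])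

end

section \<open>Passage to the limit\<close>

lemma space_borel_on: "space (borel_on T) = topspace T"
  unfolding borel_on_def by (rule space_measure_of) (auto dest: openin_subset)

lemma tuple_upto_in_topspace: "tuple_upto m v \<in> topspace (Euclidean_space (Suc m))"
  by (simp add: topspace_Euclidean_space tuple_upto_def)

lemma continuous_map_tuple_upto:
  fixes v :: "'a::topological_space \<Rightarrow> nat \<Rightarrow> real"
  assumes "\<And>k. continuous_on UNIV (\<lambda>z. v z k)"
  shows "continuous_map euclidean (Euclidean_space (Suc m)) (\<lambda>z. tuple_upto m (v z))"
proof -
  have "continuous_map euclidean euclideanreal (\<lambda>z. tuple_upto m (v z) k)" for k
    using assms by (simp add: tuple_upto_def)
  then show ?thesis
    unfolding Euclidean_space_def
    by (intro continuous_map_into_subtopology) (auto simp: continuous_map_componentwise_UNIV tuple_upto_def)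
qed

lemma measurable_borel_on_continuous:
  fixes g :: "'a::topological_space \<Rightarrow> 'b"
  assumes g: "continuous_map euclidean T g" and W: "W \<in> borel_measurable N"
  shows "(\<lambda>\<omega>. g (W \<omega>)) \<in> measurable N (borel_on T)"
  unfolding borel_on_def
proof (rule measurable_measure_of)
  show "{S. openin T S} \<subseteq> Pow (topspace T)" by (auto dest: openin_subset)
  show "(\<lambda>\<omega>. g (W \<omega>)) \<in> space N \<rightarrow> topspace T"
    using g by (auto simp: continuous_map_def)
  fix S assume "S \<in> {S. openin T S}"
  then have "open {z. g z \<in> S}"
    using g openin_continuous_map_preimage by fastforce
  then have "W -` {z. g z \<in> S} \<inter> space N \<in> sets N"
    using W by (intro measurable_sets[OF W]) simp
  then show "(\<lambda>\<omega>. g (W \<omega>)) -` S \<inter> space N \<in> sets N"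
    by (simp add: vimage_def)
qed

lemma continuous_Z_avail: "continuous_on UNIV (\<lambda>w. Z_avail P a U w k)"
  unfolding Z_avail_eq_inner by (intro continuous_intros)

locale ergodic_chain_limit = ergodic_chain M P a X \<pi> + N: prob_space N
  for M :: "'w measure" and P :: "real^'s^'s" and a :: "real^'s" and X :: "nat \<Rightarrow> 'w \<Rightarrow> 's::finite"
    and \<pi> :: "real^'s" and N :: "'v measure" +
  fixes W :: "'v \<Rightarrow> real^'s^'s"
  assumes gaussian: "centered_gaussian N W"
    and covariance_W: "covariance N (\<lambda>\<omega>. W \<omega> $ i $ j) (\<lambda>\<omega>. W \<omega> $ k $ l) =
        (if i = k then 1 / \<pi> $ i * P $ i $ j * ((if j = l then 1 else 0) - P $ i $ l) else 0)"
begin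

lemma measurable_W[measurable]: "W \<in> borel_measurable N"
  using gaussian by (simp add: centered_gaussian_def)

text \<open>Both sides are Gaussian in \<open>c\<close>: with coefficients \<open>\<pi>_i c_ij\<close>, the covariance assumption on \<open>W\<close>
  gives the variance \<open>\<Sum>_i \<pi>_i (\<Sum>_j p_ij c_ij^2 - (\<Sum>_j p_ij c_ij)^2)\<close>, the same as for the
  fluctuation matrix.\<close>

lemma limit_state_char:
  "(\<integral>\<omega>. iexp ((c, d, e) \<bullet> limit_state (W \<omega>)) \<partial>N) = iexp (d \<bullet> \<pi>) * exp (- asymptotic_variance (centering c) / 2)"
proof -
  let ?c = "\<chi> i j. \<pi> $ i * c $ i $ j"
  have lin: "(c, d, e) \<bullet> limit_state w = ?c \<bullet> w + d \<bullet> \<pi>" for w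
    by (simp add: limit_state_def inner_matrix mult_ac)
  have "(\<integral>\<omega>. (?c \<bullet> W \<omega>)\<^sup>2 \<partial>N) = covariance N (\<lambda>\<omega>. ?c \<bullet> W \<omega>) (\<lambda>\<omega>. ?c \<bullet> W \<omega>)"
    unfolding covariance_def by (simp only: gaussian_mean[OF gaussian] power2_eq_square diff_0_right)
  also have "\<dots> = (\<Sum>i\<in>UNIV. \<Sum>j\<in>UNIV. \<Sum>k\<in>UNIV. \<Sum>l\<in>UNIV. if k = i then
      \<pi> $ i * c $ i $ j * (\<pi> $ i * c $ i $ l) * (1 / \<pi> $ i * P $ i $ j * ((if j = l then 1 else 0) - P $ i $ l)) else 0)"
    unfolding gaussian_covariance[OF gaussian] covariance_W by (intro sum.cong refl) auto
  also have "\<dots> = (\<Sum>i\<in>UNIV. \<Sum>j\<in>UNIV. \<Sum>l\<in>UNIV.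
      \<pi> $ i * c $ i $ j * (\<pi> $ i * c $ i $ l) * (1 / \<pi> $ i * P $ i $ j * ((if j = l then 1 else 0) - P $ i $ l)))"
  proof (rule sum.cong[OF refl], rule sum.cong[OF refl])
    fix i j :: 's
    have "(\<Sum>k\<in>UNIV. \<Sum>l\<in>UNIV. if k = i then f l else 0) = (\<Sum>l\<in>UNIV. f l)" for f :: "'s \<Rightarrow> real"
      by (subst sum.swap) simp
    then show "(\<Sum>k\<in>UNIV. \<Sum>l\<in>UNIV. if k = i then
      \<pi> $ i * c $ i $ j * (\<pi> $ i * c $ i $ l) * (1 / \<pi> $ i * P $ i $ j * ((if j = l then 1 else 0) - P $ i $ l)) else 0) =
      (\<Sum>l\<in>UNIV. \<pi> $ i * c $ i $ j * (\<pi> $ i * c $ i $ l) * (1 / \<pi> $ i * P $ i $ j * ((if j = l then 1 else 0) - P $ i $ l)))" .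
  qed
  also have "\<dots> = asymptotic_variance (centering c)"
    unfolding asymptotic_variance_centering
  proof (intro sum.cong refl)
    fix i
    have p: "\<pi> $ i \<noteq> 0" using \<pi>_pos[of i] by simp
    have "(\<Sum>j\<in>UNIV. \<Sum>l\<in>UNIV. \<pi> $ i * c $ i $ j * (\<pi> $ i * c $ i $ l) * (1 / \<pi> $ i * P $ i $ j * ((if j = l then 1 else 0) - P $ i $ l))) =
       (\<Sum>j\<in>UNIV. \<Sum>l\<in>UNIV. \<pi> $ i * ((if j = l then P $ i $ j * (c $ i $ j)\<^sup>2 else 0) - (P $ i $ j * c $ i $ j) * (P $ i $ l * c $ i $ l)))"
      using p by (intro sum.cong refl) (simp add: power2_eq_square algebra_simps)
    also have "\<dots> = \<pi> $ i * ((\<Sum>j\<in>UNIV. \<Sum>l\<in>UNIV. if j = l then P $ i $ j * (c $ i $ j)\<^sup>2 else 0) -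
        (\<Sum>j\<in>UNIV. \<Sum>l\<in>UNIV. (P $ i $ j * c $ i $ j) * (P $ i $ l * c $ i $ l)))"
      unfolding sum_distrib_left[symmetric] sum_subtractf by (rule refl)
    also have "(\<Sum>j\<in>UNIV. \<Sum>l\<in>UNIV. if j = l then P $ i $ j * (c $ i $ j)\<^sup>2 else 0) = (\<Sum>j\<in>UNIV. P $ i $ j * (c $ i $ j)\<^sup>2)"
      by simp
    also have "(\<Sum>j\<in>UNIV. \<Sum>l\<in>UNIV. (P $ i $ j * c $ i $ j) * (P $ i $ l * c $ i $ l)) = (\<Sum>j\<in>UNIV. P $ i $ j * c $ i $ j)\<^sup>2"
      unfolding power2_eq_square sum_product by (rule refl)
    finally show "(\<Sum>j\<in>UNIV. \<Sum>l\<in>UNIV. \<pi> $ i * c $ i $ j * (\<pi> $ i * c $ i $ l) * (1 / \<pi> $ i * P $ i $ j * ((if j = l then 1 else 0) - P $ i $ l))) =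
       \<pi> $ i * ((\<Sum>j\<in>UNIV. P $ i $ j * (c $ i $ j)\<^sup>2) - (\<Sum>j\<in>UNIV. P $ i $ j * c $ i $ j)\<^sup>2)" .
  qed
  finally have var: "(\<integral>\<omega>. (?c \<bullet> W \<omega>)\<^sup>2 \<partial>N) = asymptotic_variance (centering c)" .
  have "(\<integral>\<omega>. iexp ((c, d, e) \<bullet> limit_state (W \<omega>)) \<partial>N) = (\<integral>\<omega>. iexp (d \<bullet> \<pi>) * iexp (?c \<bullet> W \<omega>) \<partial>N)"
    unfolding lin by (simp add: distrib_left exp_add mult.commute)
  also have "\<dots> = iexp (d \<bullet> \<pi>) * exp (- asymptotic_variance (centering c) / 2)"
    unfolding integral_mult_right_zero gaussian_char[OF gaussian] var by (rule refl)
  finally show ?thesis .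
qed

lemma measurable_limit_state[measurable]: "(\<lambda>\<omega>. limit_state (W \<omega>)) \<in> borel_measurable N"
proof -
  have "continuous_on UNIV limit_state"
    unfolding limit_state_def by (intro continuous_intros)
  then show ?thesis
    by (rule measurable_compose[OF measurable_W borel_measurable_continuous_onI])
qed

lemma empirical_state_converges:
  fixes f :: "(real^'s^'s) \<times> (real^'s) \<times> real \<Rightarrow> real"
  assumes "continuous_on UNIV f" "\<And>z. \<bar>f z\<bar> \<le> B"
  shows "(\<lambda>n. \<integral>\<omega>. f (empirical_state n (traj \<omega>)) \<partial>M) \<longlonglongrightarrow> (\<integral>\<omega>. f (limit_state (W \<omega>)) \<partial>N)"
proof (rule multivariate_levy_continuity[OF prob_space_axioms N.prob_space_axioms _ measurable_limit_state _ assms])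
  show "(\<lambda>\<omega>. empirical_state n (traj \<omega>)) \<in> borel_measurable M" for n
    by (rule measurable_determined[OF determined_by_empirical_state]) simp
  fix c :: "(real^'s^'s) \<times> (real^'s) \<times> real"
  show "(\<lambda>n. \<integral>\<omega>. iexp (c \<bullet> empirical_state n (traj \<omega>)) \<partial>M) \<longlonglongrightarrow> (\<integral>\<omega>. iexp (c \<bullet> limit_state (W \<omega>)) \<partial>N)"
    by (cases c) (simp only: limit_state_char empirical_state_char)
qed

text \<open>A continuous mapping theorem for functions \<open>f\<close> of the sequence of errors. The representation by
  the empirical state can fail only if some occupation fraction is below \<open>\<pi>_i / 2\<close>; by Markov's
  inequality this has vanishing probability, and there \<open>f\<close> is bounded. Asking for continuity only
  after composition with \<open>avail_error\<close> avoids a topology on sequences and serves tuples and sums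
  alike.\<close>

lemma scaled_error_converges:
  assumes cont: "continuous_on UNIV (\<lambda>z. f (avail_error U z))" and bdd: "\<And>v. \<bar>f v\<bar> \<le> (B :: real)"
  shows "(\<lambda>n. \<integral>\<omega>. f (scaled_error U n (traj \<omega>)) \<partial>M) \<longlonglongrightarrow> (\<integral>\<omega>. f (Z_avail P a U (W \<omega>)) \<partial>N)"
proof -
  have B: "0 \<le> B" using bdd[of undefined] by linarith
  let ?E = "\<lambda>n \<omega>. empirical_state n (traj \<omega>)"
  have int1: "integrable M (\<lambda>\<omega>. f (scaled_error U n (traj \<omega>)))" for n
    by (rule integrable_determined[OF determined_by_comp[OF determined_by_scaled_error[of n U], of f]])
  have int2: "integrable M (\<lambda>\<omega>. f (avail_error U (?E n \<omega>)))" for n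
    by (rule integrable_determined[OF determined_by_comp[OF determined_by_empirical_state[of n], of "\<lambda>z. f (avail_error U z)"]])
  have intL: "integrable M (\<lambda>\<omega>. \<bar>occupation n (traj \<omega>) $ i - \<pi> $ i\<bar>)" for n i
    by (rule integrable_determined[OF determined_by_comp[OF determined_by_occupation[of n], of "\<lambda>v. \<bar>v $ i - \<pi> $ i\<bar>"]])
  have "(\<lambda>n. (\<integral>\<omega>. f (scaled_error U n (traj \<omega>)) \<partial>M) - (\<integral>\<omega>. f (avail_error U (?E n \<omega>)) \<partial>M)) \<longlonglongrightarrow> 0"
  proof (rule Lim_null_comparison)
    let ?b = "\<lambda>n. 2 * B * (\<Sum>i\<in>UNIV. 2 / \<pi> $ i * (\<integral>\<omega>. \<bar>occupation n (traj \<omega>) $ i - \<pi> $ i\<bar> \<partial>M))"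
    show "\<forall>\<^sub>F n in sequentially. norm ((\<integral>\<omega>. f (scaled_error U n (traj \<omega>)) \<partial>M) - (\<integral>\<omega>. f (avail_error U (?E n \<omega>)) \<partial>M)) \<le> ?b n"
      using eventually_ge_at_top[of 1]
    proof eventually_elim
      case (elim n)
      have pt: "\<bar>f (scaled_error U n x) - f (avail_error U (empirical_state n x))\<bar> \<le>
          2 * B * (\<Sum>i\<in>UNIV. 2 / \<pi> $ i * \<bar>occupation n x $ i - \<pi> $ i\<bar>)" for x
      proof (cases "\<forall>i. \<pi> $ i / 2 \<le> occupation n x $ i")
        case True
        then have "scaled_error U n x = avail_error U (empirical_state n x)"
          using scaled_error_eq_avail_error[OF elim] by blast
        then show ?thesis
          using B \<pi>_pos by (simp add: sum_nonneg less_imp_le)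
      next
        case False
        then obtain i where i: "occupation n x $ i < \<pi> $ i / 2" by (auto simp: not_le)
        then have "\<pi> $ i / 2 \<le> \<bar>occupation n x $ i - \<pi> $ i\<bar>" by linarith
        then have "1 \<le> 2 / \<pi> $ i * \<bar>occupation n x $ i - \<pi> $ i\<bar>"
          using \<pi>_pos[of i] by (simp add: field_simps)
        also have "\<dots> \<le> (\<Sum>i\<in>UNIV. 2 / \<pi> $ i * \<bar>occupation n x $ i - \<pi> $ i\<bar>)"
          using \<pi>_pos by (intro member_le_sum) (auto simp: less_imp_le)
        finally have "2 * B * 1 \<le> 2 * B * (\<Sum>i\<in>UNIV. 2 / \<pi> $ i * \<bar>occupation n x $ i - \<pi> $ i\<bar>)"
          using B by (intro mult_left_mono) auto
        moreover have "\<bar>f (scaled_error U n x) - f (avail_error U (empirical_state n x))\<bar> \<le> 2 * B"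
          using bdd[of "scaled_error U n x"] bdd[of "avail_error U (empirical_state n x)"] by linarith
        ultimately show ?thesis by linarith
      qed
      have "norm ((\<integral>\<omega>. f (scaled_error U n (traj \<omega>)) \<partial>M) - (\<integral>\<omega>. f (avail_error U (?E n \<omega>)) \<partial>M)) =
          \<bar>\<integral>\<omega>. f (scaled_error U n (traj \<omega>)) - f (avail_error U (?E n \<omega>)) \<partial>M\<bar>"
        using int1 int2 by simp
      also have "\<dots> \<le> (\<integral>\<omega>. \<bar>f (scaled_error U n (traj \<omega>)) - f (avail_error U (?E n \<omega>))\<bar> \<partial>M)"
        by (rule integral_abs_bound)
      also have "\<dots> \<le> (\<integral>\<omega>. 2 * B * (\<Sum>i\<in>UNIV. 2 / \<pi> $ i * \<bar>occupation n (traj \<omega>) $ i - \<pi> $ i\<bar>) \<partial>M)"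
        using int1 int2 intL pt by (intro integral_mono) auto
      also have "\<dots> = ?b n"
        using intL by (simp add: Bochner_Integration.integral_sum)
      finally show ?case .
    qed
    show "?b \<longlonglongrightarrow> 0"
      by (intro tendsto_mult_right_zero tendsto_null_sum occupation_tendsto)
  qed
  moreover have "(\<lambda>n. \<integral>\<omega>. f (avail_error U (?E n \<omega>)) \<partial>M) \<longlonglongrightarrow> (\<integral>\<omega>. f (Z_avail P a U (W \<omega>)) \<partial>N)"
  proof -
    have "avail_error U (limit_state w) = Z_avail P a U w" for w
      by (rule ext) (rule avail_error_limit_state)
    then show ?thesis
      using empirical_state_converges[OF cont, of B] bdd by simp
  qed
  ultimately have "(\<lambda>n. ((\<integral>\<omega>. f (scaled_error U n (traj \<omega>)) \<partial>M) - (\<integral>\<omega>. f (avail_error U (?E n \<omega>)) \<partial>M))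
      + (\<integral>\<omega>. f (avail_error U (?E n \<omega>)) \<partial>M)) \<longlonglongrightarrow> 0 + (\<integral>\<omega>. f (Z_avail P a U (W \<omega>)) \<partial>N)"
    by (rule tendsto_add)
  then show ?thesis by simp
qed

end

context ergodic_chain_limit
begin

lemma converges_in_distribution_tuple:
  "converges_in_distribution (Euclidean_space (Suc m))
      M (\<lambda>n \<omega>. tuple_upto m (scaled_error U n (traj \<omega>))) N (\<lambda>\<omega>. tuple_upto m (Z_avail P a U (W \<omega>)))"
  unfolding converges_in_distribution_def
proof (intro conjI allI impI)
  show "(\<lambda>\<omega>. tuple_upto m (scaled_error U n (traj \<omega>))) \<in> measurable M (borel_on (Euclidean_space (Suc m)))" for n
    by (rule measurable_determined[OF determined_by_comp[OF determined_by_scaled_error[of n U], of "tuple_upto m"]])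
      (simp only: space_borel_on tuple_upto_in_topspace)
  show "(\<lambda>\<omega>. tuple_upto m (Z_avail P a U (W \<omega>))) \<in> measurable N (borel_on (Euclidean_space (Suc m)))"
    by (rule measurable_borel_on_continuous[OF continuous_map_tuple_upto[OF continuous_Z_avail] measurable_W])
  fix f :: "(nat \<Rightarrow> real) \<Rightarrow> real"
  assume f: "continuous_map (Euclidean_space (Suc m)) euclideanreal f \<and> bounded (f ` topspace (Euclidean_space (Suc m)))"
  then obtain B where B: "\<And>v. v \<in> topspace (Euclidean_space (Suc m)) \<Longrightarrow> \<bar>f v\<bar> \<le> B"
    unfolding bounded_iff by auto
  have "continuous_map euclidean euclideanreal (f \<circ> (\<lambda>z. tuple_upto m (avail_error U z)))"
    using f by (intro continuous_map_compose[OF continuous_map_tuple_upto[OF continuous_avail_error]]) simp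
  then have "continuous_on UNIV (\<lambda>z. f (tuple_upto m (avail_error U z)))"
    by (simp add: o_def)
  then show "(\<lambda>n. \<integral>\<omega>. f (tuple_upto m (scaled_error U n (traj \<omega>))) \<partial>M)
      \<longlonglongrightarrow> (\<integral>\<omega>. f (tuple_upto m (Z_avail P a U (W \<omega>))) \<partial>N)"
    by (rule scaled_error_converges[of "\<lambda>v. f (tuple_upto m v)"]) (rule B[OF tuple_upto_in_topspace])
qed

lemma weak_conv_cumulative:
  "weak_conv_m (\<lambda>n. distr M borel (\<lambda>\<omega>. \<Sum>k\<le>m. scaled_error U n (traj \<omega>) k))
     (distr N borel (\<lambda>\<omega>. \<Sum>k\<le>m. Z_avail P a U (W \<omega>) k))"
proof (rule integral_bdd_continuous_conv_imp_weak_conv)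
  have Y: "(\<lambda>\<omega>. \<Sum>k\<le>m. scaled_error U n (traj \<omega>) k) \<in> borel_measurable M" for n
    by (rule measurable_determined[OF determined_by_comp[OF determined_by_scaled_error[of n U], of "\<lambda>v. \<Sum>k\<le>m. v k"]]) simp
  have "continuous_on UNIV (\<lambda>w. \<Sum>k\<le>m. Z_avail P a U w k)"
    by (intro continuous_on_sum continuous_Z_avail)
  then have Z: "(\<lambda>\<omega>. \<Sum>k\<le>m. Z_avail P a U (W \<omega>) k) \<in> borel_measurable N"
    by (rule measurable_compose[OF measurable_W borel_measurable_continuous_onI])
  show "real_distribution (distr M borel (\<lambda>\<omega>. \<Sum>k\<le>m. scaled_error U n (traj \<omega>) k))" for n
    using Y by (rule real_distribution_distr)
  show "real_distribution (distr N borel (\<lambda>\<omega>. \<Sum>k\<le>m. Z_avail P a U (W \<omega>) k))"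
    using Z by (rule N.real_distribution_distr)
  fix f :: "real \<Rightarrow> real"
  assume f: "\<And>x. isCont f x" "\<And>x. \<bar>f x\<bar> \<le> 1"
  have cf: "continuous_on UNIV f"
    using f(1) by (simp add: continuous_at_imp_continuous_on)
  then have [measurable]: "f \<in> borel_measurable borel"
    by (rule borel_measurable_continuous_onI)
  have "continuous_on UNIV (\<lambda>z. f (\<Sum>k\<le>m. avail_error U z k))"
    by (rule continuous_on_compose2[OF cf]) (auto intro!: continuous_on_sum continuous_avail_error)
  then have "(\<lambda>n. \<integral>\<omega>. f (\<Sum>k\<le>m. scaled_error U n (traj \<omega>) k) \<partial>M) \<longlonglongrightarrow> (\<integral>\<omega>. f (\<Sum>k\<le>m. Z_avail P a U (W \<omega>) k) \<partial>N)"
    by (rule scaled_error_converges[of "\<lambda>v. f (\<Sum>k\<le>m. v k)"]) (rule f(2))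
  then show "(\<lambda>n. integral\<^sup>L (distr M borel (\<lambda>\<omega>. \<Sum>k\<le>m. scaled_error U n (traj \<omega>) k)) f)
      \<longlonglongrightarrow> integral\<^sup>L (distr N borel (\<lambda>\<omega>. \<Sum>k\<le>m. Z_avail P a U (W \<omega>) k)) f"
    using Y Z by (simp add: integral_distr)
qed

end

theorem proposition9:
  fixes P :: "real^'s^'s" and a \<pi> :: "real^'s" and U :: "'s set"
    and M :: "'w measure" and X :: "nat \<Rightarrow> 'w \<Rightarrow> 's"
    and N :: "'v measure" and W :: "'v \<Rightarrow> real^'s^'s" and m :: nat
  assumes stoch: "stochastic_matrix P"
    and irred: "irreducible_matrix P"
    and stat: "stationary_vector P \<pi>"
    and chain: "markov_chain M P a X"
    and U: "1 \<le> card U" "card U \<le> CARD('s) - 1"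
    and N: "prob_space N"
    and W_gaussian: "centered_gaussian N W"
    and W_cov: "\<And>i j k l. covariance N (\<lambda>\<omega>. W \<omega> $ i $ j) (\<lambda>\<omega>. W \<omega> $ k $ l) =
        (if i = k then 1 / \<pi> $ i * P $ i $ j * ((if j = l then 1 else 0) - P $ i $ l) else 0)"
  shows "(\<forall>k. availability M X U k = (a v* matpow P k) \<bullet> indicator_vec U) \<and>
    converges_in_distribution (Euclidean_space (Suc m))
      M (\<lambda>n \<omega>. tuple_upto m
           (\<lambda>k. sqrt (real n) * (availability_est a U k n (\<lambda>t. X t \<omega>) - availability M X U k)))
      N (\<lambda>\<omega>. tuple_upto m (Z_avail P a U (W \<omega>))) \<and>
    (\<forall>k\<le>m. \<forall>l\<le>m. covariance N (\<lambda>\<omega>. Z_avail P a U (W \<omega>) k) (\<lambda>\<omega>. Z_avail P a U (W \<omega>) l) =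
      (((rowvector a :: real^'s^1) \<otimes>\<^sub>K (rowvector (indicator_vec U) :: real^'s^1))
        ** M_mat P k ** Sigma_p N W ** transpose (M_mat P l)
        ** ((columnvector a :: real^1^'s) \<otimes>\<^sub>K (columnvector (indicator_vec U) :: real^1^'s)))
      $ (1, 1) $ (1, 1)) \<and>
    weak_conv_m
      (\<lambda>n. distr M borel (\<lambda>\<omega>. sqrt (real n) *
         ((\<Sum>k\<le>m. availability_est a U k n (\<lambda>t. X t \<omega>)) - (\<Sum>k\<le>m. availability M X U k))))
      (distr N borel (\<lambda>\<omega>. \<Sum>k\<le>m. Z_avail P a U (W \<omega>) k))"
proof -
  interpret N: prob_space N by (rule N)
  interpret ergodic_chain_limit M P a X \<pi> N W
    by unfold_locales (fact chain stoch irred stat W_gaussian W_cov)+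
  have tuple: "tuple_upto m (\<lambda>k. sqrt (real n) * (availability_est a U k n (traj \<omega>) - availability M X U k)) =
      tuple_upto m (scaled_error U n (traj \<omega>))" for n \<omega>
    unfolding scaled_error_def by (rule refl)
  have total: "sqrt (real n) * ((\<Sum>k\<le>m. availability_est a U k n (traj \<omega>)) - (\<Sum>k\<le>m. availability M X U k)) =
      (\<Sum>k\<le>m. scaled_error U n (traj \<omega>) k)" for n \<omega>
    unfolding scaled_error_def by (simp only: sum_subtractf sum_distrib_left right_diff_distrib)
  show ?thesis
    unfolding tuple total
    by (intro conjI allI impI availability_eq converges_in_distribution_tuple covariance_Z_avail
        W_gaussian weak_conv_cumulative)
qed

end
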